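(* Let $\varphi\in L^{2}(\mathbb{R}^{2n})$ satisfy condition C. Suppose $w_{\varphi}(\xi)>0$ for a.e. $\xi\in\mathbb{T}^{n}$. Then $\{T^{t}_{(k,l)}\varphi:(k,l)\in\mathbb{Z}^{2n}\}$ is $\ell^{2}$-linearly independent.
   Context: $\mathbb{T}^{n}$ is identified with $[0,1)^{n}$ with Lebesgue measure. Twisted translation: for $\varphi\in L^{2}(\mathbb{R}^{2n})$ and $(k,l)\in\mathbb{Z}^{2n}$ (with $k,l\in\mathbb{Z}^n$), $T^{t}_{(k,l)}\varphi(x,y)=e^{\pi i(x\cdot l-y\cdot k)}\varphi(x-k,y-l)$, $(x,y)\in\mathbb{R}^{n}\times\mathbb{R}^{n}$. Kernel of the Weyl transform: for $f\in L^{2}(\mathbb{R}^{2n})$, $K_{f}(\xi,\eta)=\int_{\mathbb{R}^{n}}f(x,\eta-\xi)e^{i\pi x\cdot(\xi+\eta)}dx$ (interpreted in the $L^{2}$ sense as a partial Fourier transform; $f\mapsto K_f$ is an isometry of $L^{2}(\mathbb{R}^{2n})$). $w_{\varphi}(\xi)=\sum_{m\in\mathbb{Z}^{n}}\int_{\mathbb{R}^{n}}|K_{\varphi}(\xi+m,\eta)|^{2}d\eta$ for $\xi\in\mathbb{R}^{n}$; this is $\mathbb{Z}^{n}$-periodic and is regarded also as a function on $\mathbb{T}^{n}$. Condition C: $\varphi$ satisfies condition C if for every $l\in\mathbb{Z}^{n}\setminus\{0\}$, $\sum_{m\in\mathbb{Z}^{n}}\int_{\mathbb{R}^{n}}K_{\varphi}(\xi+m,\eta)\overline{K_{\varphi}(\xi+m+l,\eta)}\,d\eta=0$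 for a.e. $\xi\in\mathbb{T}^{n}$. A family $\{f_{j}:j\in\mathbb{Z}^{d}\}$ in a Hilbert space $\mathcal{H}$ is $\ell^{2}$-linearly dependent if there is a non-zero sequence $\{c_{j}\}\in\ell^{2}(\mathbb{Z}^{d})$ with $\sum_{j\in\mathbb{Z}^{d}}c_{j}f_{j}=0$; otherwise it is $\ell^{2}$-linearly independent. Convergence of a series over $\mathbb{Z}^{d}$ means norm convergence in $\mathcal{H}$ of the partial sums over $\{j:\max_i|j_i|\le N\}$ as $N\to\infty$. *)

theory Defs
  imports "HOL-Analysis.Analysis"
begin

text \<open>
  \<open>\<real>\<^sup>n\<close> is \<^typ>\<open>real ^ 'n\<close>, \<open>\<int>\<^sup>n\<close> is \<^typ>\<open>int ^ 'n\<close>, and \<open>\<real>\<^sup>2\<^sup>n\<close>, \<open>\<int>\<^sup>2\<^sup>n\<close> are pairs of these.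
  Elements of \<open>L\<^sup>2\<close> are represented by Lebesgue measurable functions; every notion below is
  invariant under modification of such a function on a null set.
\<close>

definition int_vec :: "int ^ 'n \<Rightarrow> real ^ 'n" where
  "int_vec k = (\<chi> i. real_of_int (k $ i))"

definition torus :: "(real ^ 'n) set" where
  "torus = {\<xi>. \<forall>i. 0 \<le> \<xi> $ i \<and> \<xi> $ i < 1}"

definition in_L2 :: "('a::euclidean_space \<Rightarrow> complex) \<Rightarrow> bool" where
  "in_L2 f \<longleftrightarrow> f \<in> borel_measurable lebesgue \<and> integrable lebesgue (\<lambda>z. (cmod (f z))\<^sup>2)"

definition L2_limit :: "(nat \<Rightarrow> 'a::euclidean_space \<Rightarrow> complex) \<Rightarrow> ('a \<Rightarrow> complex) \<Rightarrow> bool" where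
  "L2_limit F f \<longleftrightarrow>
     (\<lambda>N. \<integral>\<^sup>+ z. ennreal ((cmod (F N z - f z))\<^sup>2) \<partial>lebesgue) \<longlonglongrightarrow> 0"

definition twisted_translation ::
  "(int ^ 'n) \<times> (int ^ 'n) \<Rightarrow> ((real ^ 'n) \<times> (real ^ 'n) \<Rightarrow> complex) \<Rightarrow> (real ^ 'n) \<times> (real ^ 'n) \<Rightarrow> complex"
where
  "twisted_translation = (\<lambda>(k, l) \<phi> (x, y).
     cis (pi * (x \<bullet> int_vec l - y \<bullet> int_vec k)) * \<phi> (x - int_vec k, y - int_vec l))"

text \<open>
  For a general \<open>f\<close> in \<open>L\<^sup>2\<close> the integral defining the kernel need not converge absolutely. As usual
  for the Fourier--Plancherel transform, the kernel is the \<open>L\<^sup>2\<close> limit of the integrals over the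
  balls of radius \<open>N\<close>. For almost every \<open>(\<xi>, \<eta>)\<close> the function \<open>f (\<cdot>, \<eta> - \<xi>)\<close> is square integrable,
  hence integrable on balls. The limit exists by Plancherel's theorem and is unique up to
  null sets, so the choice in \<open>weyl_kernel\<close> is only a choice of representative.
\<close>

definition truncated_weyl_kernel ::
  "nat \<Rightarrow> ((real ^ 'n) \<times> (real ^ 'n) \<Rightarrow> complex) \<Rightarrow> (real ^ 'n) \<times> (real ^ 'n) \<Rightarrow> complex" where
  "truncated_weyl_kernel N f = (\<lambda>(\<xi>, \<eta>).
     LINT x:cball 0 (real N)|lebesgue. f (x, \<eta> - \<xi>) * cis (pi * (x \<bullet> (\<xi> + \<eta>))))"

definition weyl_kernel ::
  "((real ^ 'n) \<times> (real ^ 'n) \<Rightarrow> complex) \<Rightarrow> (real ^ 'n) \<times> (real ^ 'n) \<Rightarrow> complex" where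
  "weyl_kernel f = (SOME K. in_L2 K \<and> L2_limit (\<lambda>N. truncated_weyl_kernel N f) K)"

text \<open>
  The values lie in \<^typ>\<open>ennreal\<close> because the sum may be infinite for \<open>\<xi>\<close> in a null set.
\<close>

definition weight :: "((real ^ 'n) \<times> (real ^ 'n) \<Rightarrow> complex) \<Rightarrow> real ^ 'n \<Rightarrow> ennreal" where
  "weight \<phi> \<xi> =
     (\<Sum>\<^sub>\<infinity> m. \<integral>\<^sup>+ \<eta>. ennreal ((cmod (weyl_kernel \<phi> (\<xi> + int_vec m, \<eta>)))\<^sup>2) \<partial>lebesgue)"

text \<open>
  For \<open>\<phi>\<close> in \<open>L\<^sup>2\<close>, Cauchy--Schwarz shows that for almost every \<open>\<xi>\<close> all integrals below exist and
  the series over \<open>\<int>\<^sup>n\<close> converges absolutely, so the order of summation is immaterial.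
\<close>

definition condition_C :: "((real ^ 'n) \<times> (real ^ 'n) \<Rightarrow> complex) \<Rightarrow> bool" where
  "condition_C \<phi> \<longleftrightarrow> (\<forall>l. l \<noteq> 0 \<longrightarrow>
     (AE \<xi> in lebesgue_on torus.
        ((\<lambda>m. LINT \<eta>|lebesgue. weyl_kernel \<phi> (\<xi> + int_vec m, \<eta>) *
                cnj (weyl_kernel \<phi> (\<xi> + int_vec m + int_vec l, \<eta>))) has_sum 0) UNIV))"

definition index_cube :: "nat \<Rightarrow> ((int ^ 'n) \<times> (int ^ 'n)) set" where
  "index_cube N = {(k, l). \<forall>i. \<bar>k $ i\<bar> \<le> int N \<and> \<bar>l $ i\<bar> \<le> int N}"

definition ell2_dependent ::
  "((int ^ 'n) \<times> (int ^ 'n) \<Rightarrow> 'a::euclidean_space \<Rightarrow> complex) \<Rightarrow> bool" where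
  "ell2_dependent f \<longleftrightarrow>
     (\<exists>c :: (int ^ 'n) \<times> (int ^ 'n) \<Rightarrow> complex.
        (\<exists>j. c j \<noteq> 0) \<and> (\<lambda>j. (cmod (c j))\<^sup>2) summable_on UNIV \<and>
        L2_limit (\<lambda>N z. \<Sum>j\<in>index_cube N. c j * f j z) (\<lambda>_. 0))"

abbreviation ell2_independent ::
  "((int ^ 'n) \<times> (int ^ 'n) \<Rightarrow> 'a::euclidean_space \<Rightarrow> complex) \<Rightarrow> bool" where
  "ell2_independent f \<equiv> \<not> ell2_dependent f"

end

theory Submission
  imports Defs
begin

text \<open>
  The Weyl kernel turns twisted translations into modulated shifts of the first variable: if \<open>K\<close> is
  the kernel of \<open>\<phi>\<close>, then the kernel of \<open>T\<^bsub>(k,l)\<^esub>\<phi>\<close> is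
  \<open>e\<^bsup>\<pi>i k\<cdot>l\<^esup> e\<^bsup>2\<pi>i k\<cdot>\<xi>\<^esup> K(\<xi> + l, \<eta>)\<close>. A finite combination of the translates
  therefore has the kernel \<open>\<Sum>\<^sub>l A\<^sub>l(\<xi>) K(\<xi> + l, \<eta>)\<close>, where \<open>A\<^sub>l\<close> is the trigonometric polynomial
  with the coefficients \<open>c\<^bsub>(k,l)\<^esub> e\<^bsup>\<pi>i k\<cdot>l\<^esup>\<close>. Fold its squared norm into an integral over the torus. For
  fixed \<open>\<xi>\<close>, condition C says that the sequences \<open>m \<mapsto> K(\<xi> + m + l, \<cdot>)\<close>, for the various \<open>l\<close>, are
  pairwise orthogonal, and each of them has the squared norm \<open>w(\<xi>)\<close>; by Pythagoras the squared
  norm of the kernel is \<open>\<Sum>\<^sub>l \<integral> |A\<^sub>l|\<^sup>2 w\<close> (\<open>weighted_coefficient_polynomial_le\<close>).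

  Suppose that the cubic partial sums tend to \<open>0\<close>. Then \<open>\<integral> |A\<^sub>l|\<^sup>2 w\<close> tends to \<open>0\<close> for every \<open>l\<close>,
  while the polynomials \<open>A\<^sub>l\<close> stay bounded in \<open>L\<^sup>2\<close> of the torus because \<open>c\<close> is square summable.
  Where \<open>w\<close> is not small this forces \<open>A\<^sub>l\<close> to be small, and the set where \<open>w\<close> is small has small
  measure because \<open>w > 0\<close> almost everywhere. So \<open>\<integral> |A\<^sub>l|\<close> tends to \<open>0\<close>, and with it every Fourier
  coefficient of \<open>A\<^sub>l\<close>. Each of these coefficients is eventually constant, hence it is \<open>0\<close>
  (\<open>coefficient_vanishes\<close>).

  The passage to kernels needs two facts: that the kernel exists as an \<open>L\<^sup>2\<close> limit
  (\<open>weyl_kernel_borel_representatives\<close>), and that the norm of a combination of kernels is at most a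
  constant times the norm of the same combination of functions (\<open>L2sq_kernel_combination_le\<close>). Both
  follow from the upper half of Plancherel's theorem for functions with bounded support in \<open>x\<close>, and
  this half is Bessel's inequality for Fourier series: for a function supported in a cube of side
  \<open>r\<close>, the values of its Fourier transform on a coset of \<open>r\<^bsup>-1\<^esup> \<int>\<^sup>n\<close> are the Fourier coefficients of a
  modulation of the function, and integrating over the cosets gives the bound
  (\<open>plancherel_inequality_cell_support\<close>).
\<close>

section \<open>Lattice cells and periodic functions\<close>

lemma int_vec_simps [simp]:
  "int_vec 0 = 0" "int_vec (k + l) = int_vec k + int_vec l" "int_vec (k - l) = int_vec k - int_vec l"
  "int_vec (- k) = - int_vec k" "int_vec k $ i = real_of_int (k $ i)"
  by (simp_all add: int_vec_def vec_eq_iff)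

definition cell :: "real \<Rightarrow> real \<Rightarrow> (real ^ 'n) set" where
  "cell a r = {x. \<forall>i. a \<le> x $ i \<and> x $ i < a + r}"

lemma torus_eq_cell: "torus = cell 0 1"
  by (simp add: torus_def cell_def)

lemma cell_measurable [measurable]: "cell a r \<in> sets borel"
proof -
  have "cell a r = (\<Inter>i. {x. a \<le> x $ i} \<inter> {x. x $ i < a + r})"
    by (auto simp: cell_def)
  also have "\<dots> \<in> sets borel"
    by (intro sets.finite_INT sets.Int borel_closed borel_open closed_Collect_le open_Collect_less
        continuous_intros) auto
  finally show ?thesis .
qed

lemma emeasure_cell:
  assumes "0 \<le> r"
  shows "emeasure lborel (cell a r :: (real ^ 'n) set) = ennreal (r ^ CARD('n))"
proof -
  define l u :: "real ^ 'n" where "l = (\<chi> i. a)" and "u = (\<chi> i. a + r)"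
  have B: "l \<bullet> b = a" "u \<bullet> b = a + r" "(u - l) \<bullet> b = r" if "b \<in> Basis" for b
    using that by (auto simp: l_def u_def Basis_vec_def inner_axis)
  have le: "l \<bullet> b \<le> u \<bullet> b" if "b \<in> Basis" for b
    using B[OF that] assms by simp
  have prod: "(\<Prod>b\<in>Basis. (u - l) \<bullet> b) = r ^ CARD('n)"
    using B(3) by simp
  have "emeasure lborel (box l u) \<le> emeasure lborel (cell a r :: (real ^ 'n) set)"
    by (rule emeasure_mono) (auto simp: cell_def l_def u_def mem_box_cart less_imp_le)
  moreover have "emeasure lborel (cell a r :: (real ^ 'n) set) \<le> emeasure lborel (cbox l u)"
    by (rule emeasure_mono) (auto simp: cell_def l_def u_def mem_box_cart less_imp_le)
  ultimately show ?thesis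
    using emeasure_lborel_box[OF le] emeasure_lborel_cbox[OF le] prod by simp
qed

lemma measure_cell:
  "0 \<le> r \<Longrightarrow> measure lborel (cell a r :: (real ^ 'n) set) = r ^ CARD('n)"
  by (simp add: measure_def emeasure_cell)

lemma nn_integral_lborel_translate:
  fixes h :: "'a::euclidean_space \<Rightarrow> ennreal"
  assumes [measurable]: "h \<in> borel_measurable borel"
  shows "(\<integral>\<^sup>+x. h (x + c) \<partial>lborel) = (\<integral>\<^sup>+x. h x \<partial>lborel)"
proof -
  have "(\<integral>\<^sup>+x. h x \<partial>lborel) = (\<integral>\<^sup>+x. h x \<partial>distr lborel borel ((+) c))"
    by (simp only: lborel_distr_plus)
  also have "\<dots> = (\<integral>\<^sup>+x. h (c + x) \<partial>lborel)"
    by (rule nn_integral_distr) auto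
  finally show ?thesis by (simp add: add.commute)
qed

lemma integral_lborel_translate:
  fixes h :: "'a::euclidean_space \<Rightarrow> complex"
  assumes [measurable]: "h \<in> borel_measurable borel"
  shows "(\<integral>x. h (x + c) \<partial>lborel) = (\<integral>x. h x \<partial>lborel)"
proof -
  have "(\<integral>x. h x \<partial>lborel) = (\<integral>x. h x \<partial>distr lborel borel ((+) c))"
    by (simp only: lborel_distr_plus)
  also have "\<dots> = (\<integral>x. h (c + x) \<partial>lborel)"
    by (rule integral_distr) auto
  finally show ?thesis by (simp add: add.commute)
qed

lemma AE_lborel_translate:
  assumes "AE x in lborel. P (x::'a::euclidean_space)"
  shows "AE x in lborel. P (x + c)"
proof -
  have "AE x in distr lborel borel ((+) c). P x"
    using assms by (simp only: lborel_distr_plus)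
  then have "AE x in lborel. P (c + x)"
    by (rule AE_distrD[rotated]) auto
  then show ?thesis by (simp add: add.commute)
qed

lemma cell_lattice_ex1:
  assumes "0 < r"
  shows "\<exists>!m. (x :: real ^ 'n) + r *\<^sub>R int_vec m \<in> cell a r"
proof -
  have *: "(a \<le> x $ i + r * real_of_int k \<and> x $ i + r * real_of_int k < a + r)
      \<longleftrightarrow> k = \<lceil>(a - x $ i) / r\<rceil>" for i k
  proof -
    have "a \<le> x $ i + r * real_of_int k \<longleftrightarrow> (a - x $ i) / r \<le> real_of_int k"
      using assms by (simp add: field_simps)
    moreover have "x $ i + r * real_of_int k < a + r \<longleftrightarrow> real_of_int k - 1 < (a - x $ i) / r"
      using assms by (simp add: field_simps)
    ultimately show ?thesis
      by (simp add: eq_commute[of k] ceiling_eq_iff) auto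
  qed
  show ?thesis
    by (rule ex1I[of _ "\<chi> i. \<lceil>(a - x $ i) / r\<rceil>"]) (auto simp: cell_def * vec_eq_iff)
qed

lemma nn_integral_lattice_cell:
  assumes "0 < r"
  shows "(\<integral>\<^sup>+m. indicator (cell a r) ((x :: real ^ 'n) + r *\<^sub>R int_vec m) \<partial>count_space UNIV) = 1"
proof -
  obtain m0 where m0: "x + r *\<^sub>R int_vec m \<in> cell a r \<longleftrightarrow> m = m0" for m
    using cell_lattice_ex1[OF assms, of x a] by auto
  have "(\<integral>\<^sup>+m. indicator (cell a r) (x + r *\<^sub>R int_vec m) \<partial>count_space UNIV)
      = (\<integral>\<^sup>+m. indicator {m0} m \<partial>count_space UNIV)"
    by (intro nn_integral_cong) (auto simp: m0 indicator_def)
  then show ?thesis by simp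
qed

text \<open>
  The translates of a cell by the lattice \<open>r \<int>\<^sup>n\<close> tile the space, so an integral over the space is
  the integral over one cell of the sum over the lattice.
\<close>

lemma nn_integral_unfold:
  fixes h :: "real ^ 'n \<Rightarrow> ennreal"
  assumes r: "0 < r" and [measurable]: "h \<in> borel_measurable borel"
  shows "(\<integral>\<^sup>+x. h x \<partial>lborel)
    = (\<integral>\<^sup>+x\<in>cell a r. (\<integral>\<^sup>+m. h (x + r *\<^sub>R int_vec m) \<partial>count_space UNIV) \<partial>lborel)"
proof -
  have "(\<integral>\<^sup>+x. h x \<partial>lborel)
      = (\<integral>\<^sup>+x. (\<integral>\<^sup>+m. h x * indicator (cell a r) (x + r *\<^sub>R int_vec m) \<partial>count_space UNIV) \<partial>lborel)"
    by (simp add: nn_integral_cmult nn_integral_lattice_cell[OF r])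
  also have "\<dots> = (\<integral>\<^sup>+m. (\<integral>\<^sup>+x. h x * indicator (cell a r) (x + r *\<^sub>R int_vec m) \<partial>lborel) \<partial>count_space UNIV)"
    by (rule nn_integral_count_space_nn_integral) auto
  also have "\<dots> = (\<integral>\<^sup>+m. (\<integral>\<^sup>+x. h (x - r *\<^sub>R int_vec m) * indicator (cell a r) x \<partial>lborel) \<partial>count_space UNIV)"
  proof (rule nn_integral_cong)
    fix m :: "int ^ 'n"
    show "(\<integral>\<^sup>+x. h x * indicator (cell a r) (x + r *\<^sub>R int_vec m) \<partial>lborel)
        = (\<integral>\<^sup>+x. h (x - r *\<^sub>R int_vec m) * indicator (cell a r) x \<partial>lborel)"
      by (subst nn_integral_lborel_translate[symmetric, where c = "- (r *\<^sub>R int_vec m)"]) auto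
  qed
  also have "\<dots> = (\<integral>\<^sup>+m. (\<integral>\<^sup>+x. h (x - r *\<^sub>R int_vec (- m)) * indicator (cell a r) x \<partial>lborel) \<partial>count_space UNIV)"
    by (rule nn_integral_bij_count_space[symmetric, OF bij_uminus])
  also have "\<dots> = (\<integral>\<^sup>+x. (\<integral>\<^sup>+m. h (x + r *\<^sub>R int_vec m) * indicator (cell a r) x \<partial>count_space UNIV) \<partial>lborel)"
    by (subst nn_integral_count_space_nn_integral) auto
  also have "\<dots> = (\<integral>\<^sup>+x\<in>cell a r. (\<integral>\<^sup>+m. h (x + r *\<^sub>R int_vec m) \<partial>count_space UNIV) \<partial>lborel)"
    by (simp add: nn_integral_multc)
  finally show ?thesis .
qed

text \<open>
  A shifted cell is another fundamental domain of the same lattice, and all fundamental domains give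
  a periodic function the same integral.
\<close>

lemma nn_integral_cell_periodic:
  fixes h :: "real ^ 'n \<Rightarrow> ennreal"
  assumes r: "0 < r" and [measurable]: "h \<in> borel_measurable borel"
    and per: "\<And>x m. h (x + r *\<^sub>R int_vec m) = h x"
  shows "(\<integral>\<^sup>+x\<in>cell a r. h (x + b) \<partial>lborel) = (\<integral>\<^sup>+x\<in>cell a r. h x \<partial>lborel)"
proof -
  have "(\<integral>\<^sup>+x\<in>cell a r. h (x + b) \<partial>lborel) = (\<integral>\<^sup>+x. h x * indicator (cell a r) (x - b) \<partial>lborel)"
    by (subst nn_integral_lborel_translate[symmetric, where c = b]) auto
  also have "\<dots> = (\<integral>\<^sup>+x\<in>cell a r. (\<integral>\<^sup>+m. h (x + r *\<^sub>R int_vec m) *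
      indicator (cell a r) (x + r *\<^sub>R int_vec m - b) \<partial>count_space UNIV) \<partial>lborel)"
    by (rule nn_integral_unfold[OF r]) simp
  also have "\<dots> = (\<integral>\<^sup>+x\<in>cell a r. (\<integral>\<^sup>+m. h x *
      indicator (cell a r) ((x - b) + r *\<^sub>R int_vec m) \<partial>count_space UNIV) \<partial>lborel)"
    by (simp add: per algebra_simps)
  also have "\<dots> = (\<integral>\<^sup>+x\<in>cell a r. h x \<partial>lborel)"
    by (simp add: nn_integral_cmult nn_integral_lattice_cell[OF r])
  finally show ?thesis .
qed

section \<open>Fourier series on a cell\<close>

lemma borel_measurable_cnj [measurable (raw)]:
  "f \<in> borel_measurable M \<Longrightarrow> (\<lambda>x. cnj (f x)) \<in> borel_measurable M"
  by (rule measurable_compose[of f M borel cnj])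
     (auto intro!: borel_measurable_continuous_onI continuous_intros)

definition lattice_char :: "real \<Rightarrow> int ^ 'n \<Rightarrow> real ^ 'n \<Rightarrow> complex" where
  "lattice_char r m x = cis (2 * pi * (x \<bullet> int_vec m) / r)"

abbreviation cell_measure :: "real \<Rightarrow> real \<Rightarrow> (real ^ 'n) measure" where
  "cell_measure a r \<equiv> restrict_space lborel (cell a r)"

lemma borel_measurable_cell_measure [measurable (raw)]:
  "f \<in> borel_measurable borel \<Longrightarrow> f \<in> borel_measurable (cell_measure a r)"
  by (simp add: measurable_restrict_space1)

lemma finite_cell_measure: "0 \<le> r \<Longrightarrow> finite_measure (cell_measure a r)"
  by (rule finite_measureI) (simp add: emeasure_restrict_space emeasure_cell)

lemma integrable_cell_bounded:
  fixes f :: "real ^ 'n \<Rightarrow> 'b::{banach, second_countable_topology}"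
  assumes "0 \<le> r" "f \<in> borel_measurable borel" "\<And>x. norm (f x) \<le> B"
  shows "integrable (cell_measure a r) f"
  using assms by (intro finite_measure.integrable_const_bound[OF finite_cell_measure, where B = B]) auto

lemma inner_int_vec: "int_vec k \<bullet> int_vec m = real_of_int (\<Sum>i\<in>UNIV. k $ i * m $ i)"
  by (simp add: inner_vec_def)

lemma cis_2pi_int_vec [simp]: "cis (2 * pi * (int_vec k \<bullet> int_vec m)) = 1"
  unfolding inner_int_vec by (rule cis_multiple_2pi) (rule Ints_of_int)

lemma lattice_char_measurable [measurable]: "lattice_char r m \<in> borel_measurable borel"
  unfolding lattice_char_def divide_inverse
  by (intro borel_measurable_continuous_onI continuous_intros)

lemma norm_lattice_char [simp]: "cmod (lattice_char r m x) = 1"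
  by (simp add: lattice_char_def)

lemma lattice_char_zero [simp]: "lattice_char r 0 x = 1"
  by (simp add: lattice_char_def)

lemma lattice_char_mult_cnj:
  "lattice_char r m x * cnj (lattice_char r k x) = lattice_char r (m - k) x"
  by (simp add: lattice_char_def cis_cnj cis_mult inner_diff_right right_diff_distrib diff_divide_distrib)

lemma lattice_char_periodic:
  assumes "0 < r"
  shows "lattice_char r m (x + r *\<^sub>R int_vec k) = lattice_char r m x"
proof -
  have "2 * pi * ((x + r *\<^sub>R int_vec k) \<bullet> int_vec m) / r
      = 2 * pi * (x \<bullet> int_vec m) / r + 2 * pi * (int_vec k \<bullet> int_vec m)"
    using assms by (simp add: inner_add_left field_simps)
  then show ?thesis
    by (simp add: lattice_char_def cis_mult[symmetric])
qed

text \<open>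
  This replaces the computation of the integral of a nontrivial character as a product of
  one-dimensional integrals: a shift by \<open>b\<close> preserves the integral of a periodic function and
  changes the sign of \<open>g\<close>. The proof works with \<open>1 \<plusminus> g \<ge> 0\<close> so that nonnegative integrals
  suffice.
\<close>

lemma integral_cell_antiperiodic:
  fixes g :: "real ^ 'n \<Rightarrow> real"
  assumes r: "0 < r" and [measurable]: "g \<in> borel_measurable borel"
    and bound: "\<And>x. \<bar>g x\<bar> \<le> 1"
    and per: "\<And>x m. g (x + r *\<^sub>R int_vec m) = g x"
    and anti: "\<And>x. g (x + b) = - g x"
  shows "(\<integral>x. g x \<partial>cell_measure a r) = 0"
proof -
  have int: "integrable (cell_measure a r) g" "integrable (cell_measure a r) (\<lambda>_ :: real ^ 'n. 1 :: real)"
    using r bound by (auto intro!: integrable_cell_bounded[where B = 1])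
  have pos: "0 \<le> 1 + g x" "0 \<le> 1 - g x" for x
    using bound[of x] by (simp_all add: abs_le_iff)
  have "(\<integral>\<^sup>+x. ennreal (1 + g (x + b)) \<partial>cell_measure a r) = (\<integral>\<^sup>+x. ennreal (1 + g x) \<partial>cell_measure a r)"
    using nn_integral_cell_periodic[OF r, where h = "\<lambda>x. ennreal (1 + g x)" and a = a and b = b]
    by (simp add: nn_integral_restrict_space per)
  moreover have "(\<integral>\<^sup>+x. ennreal (1 + g (x + b)) \<partial>cell_measure a r)
      = ennreal (\<integral>x. 1 - g x \<partial>cell_measure a r)"
    unfolding anti diff_conv_add_uminus[symmetric]
    using int pos by (intro nn_integral_eq_integral) auto
  moreover have "(\<integral>\<^sup>+x. ennreal (1 + g x) \<partial>cell_measure a r) = ennreal (\<integral>x. 1 + g x \<partial>cell_measure a r)"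
    using int pos by (intro nn_integral_eq_integral) auto
  moreover have "0 \<le> (\<integral>x. 1 - g x \<partial>cell_measure a r)" "0 \<le> (\<integral>x. 1 + g x \<partial>cell_measure a r)"
    using pos by (simp_all add: integral_nonneg_AE)
  ultimately have "(\<integral>x. 1 - g x \<partial>cell_measure a r) = (\<integral>x. 1 + g x \<partial>cell_measure a r)"
    by simp
  then show ?thesis using int by simp
qed

lemma integral_lattice_char:
  fixes m :: "int ^ 'n"
  assumes r: "0 < r"
  shows "(\<integral>x. lattice_char r m x \<partial>cell_measure a r) = (if m = 0 then r ^ CARD('n) else 0)"
proof (cases "m = 0")
  case True
  then show ?thesis
    using r by (simp add: measure_restrict_space measure_cell scaleR_conv_of_real)
next
  case False
  then obtain i where i: "m $ i \<noteq> 0" by (auto simp: vec_eq_iff)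
  \<comment> \<open>half a period of the character along an axis on which its frequency does not vanish\<close>
  define b :: "real ^ 'n" where "b = axis i (r / (2 * m $ i))"
  have "b \<bullet> int_vec m = r / 2"
    using i by (simp add: b_def inner_axis')
  then have "2 * pi * ((x + b) \<bullet> int_vec m) / r = 2 * pi * (x \<bullet> int_vec m) / r + pi" for x
    using r by (simp add: inner_add_left field_simps)
  then have anti: "lattice_char r m (x + b) = - lattice_char r m x" for x
    by (simp add: lattice_char_def cis_mult[symmetric])
  have int: "integrable (cell_measure a r) (lattice_char r m)"
    using r by (intro integrable_cell_bounded[where B = 1]) auto
  have "Re (\<integral>x. lattice_char r m x \<partial>cell_measure a r) = (\<integral>x. Re (lattice_char r m x) \<partial>cell_measure a r)"
    by (rule integral_Re[OF int, symmetric])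
  also have "\<dots> = 0"
    by (rule integral_cell_antiperiodic[OF r, where b = b])
       (auto simp: anti lattice_char_periodic[OF r] intro: order_trans[OF abs_Re_le_cmod])
  finally have Re: "Re (\<integral>x. lattice_char r m x \<partial>cell_measure a r) = 0" .
  have "Im (\<integral>x. lattice_char r m x \<partial>cell_measure a r) = (\<integral>x. Im (lattice_char r m x) \<partial>cell_measure a r)"
    by (rule integral_Im[OF int, symmetric])
  also have "\<dots> = 0"
    by (rule integral_cell_antiperiodic[OF r, where b = b])
       (auto simp: anti lattice_char_periodic[OF r] intro: order_trans[OF abs_Im_le_cmod])
  finally show ?thesis
    using Re False by (simp add: complex_eq_iff)
qed

lemma trig_poly_coefficient:
  fixes m :: "int ^ 'n"
  assumes r: "0 < r" and S: "finite S"
  shows "(\<integral>x. (\<Sum>k\<in>S. c k * lattice_char r k x) * cnj (lattice_char r m x) \<partial>cell_measure a r)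
    = (if m \<in> S then r ^ CARD('n) * c m else 0)"
proof -
  have int: "integrable (cell_measure a r) (lattice_char r k)" for k :: "int ^ 'n"
    using r by (intro integrable_cell_bounded[where B = 1]) auto
  have "(\<integral>x. (\<Sum>k\<in>S. c k * lattice_char r k x) * cnj (lattice_char r m x) \<partial>cell_measure a r)
      = (\<integral>x. (\<Sum>k\<in>S. c k * lattice_char r (k - m) x) \<partial>cell_measure a r)"
    by (simp add: sum_distrib_right mult.assoc lattice_char_mult_cnj)
  also have "\<dots> = (\<Sum>k\<in>S. c k * (\<integral>x. lattice_char r (k - m) x \<partial>cell_measure a r))"
    using int by simp
  also have "\<dots> = (\<Sum>k\<in>S. if k = m then c k * r ^ CARD('n) else 0)"
    by (intro sum.cong) (auto simp: integral_lattice_char[OF r])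
  also have "\<dots> = (if m \<in> S then r ^ CARD('n) * c m else 0)"
    using S by (simp add: sum.delta)
  finally show ?thesis by simp
qed

lemma trig_poly_bound:
  "cmod (\<Sum>k\<in>S. c k * lattice_char r k x) \<le> (\<Sum>k\<in>S. cmod (c k))"
  by (rule order_trans[OF norm_sum]) (simp add: norm_mult)

lemma trig_poly_parseval:
  fixes c :: "int ^ 'n \<Rightarrow> complex"
  assumes r: "0 < r" and S: "finite S"
  shows "(\<integral>x. (cmod (\<Sum>k\<in>S. c k * lattice_char r k x))\<^sup>2 \<partial>cell_measure a r)
    = r ^ CARD('n) * (\<Sum>k\<in>S. (cmod (c k))\<^sup>2)"
proof -
  define P where "P x = (\<Sum>k\<in>S. c k * lattice_char r k x)" for x
  have [measurable]: "P \<in> borel_measurable borel"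
    unfolding P_def by measurable
  have int: "integrable (cell_measure a r) (\<lambda>x. P x * cnj (lattice_char r m x))" for m
    using r trig_poly_bound[of c r _ S]
    by (intro integrable_cell_bounded[where B = "\<Sum>k\<in>S. cmod (c k)"]) (auto simp: norm_mult P_def)
  have "complex_of_real (\<integral>x. (cmod (P x))\<^sup>2 \<partial>cell_measure a r)
      = (\<integral>x. P x * cnj (P x) \<partial>cell_measure a r)"
    by (simp only: integral_complex_of_real[symmetric] complex_norm_square)
  also have "\<dots> = (\<integral>x. (\<Sum>m\<in>S. cnj (c m) * (P x * cnj (lattice_char r m x))) \<partial>cell_measure a r)"
    by (subst (2) P_def) (simp add: sum_distrib_left algebra_simps)
  also have "\<dots> = (\<Sum>m\<in>S. cnj (c m) * (\<integral>x. P x * cnj (lattice_char r m x) \<partial>cell_measure a r))"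
    using int by simp
  also have "\<dots> = (\<Sum>m\<in>S. cnj (c m) * (r ^ CARD('n) * c m))"
    unfolding P_def by (intro sum.cong) (auto simp: trig_poly_coefficient[OF r S])
  also have "\<dots> = complex_of_real (r ^ CARD('n) * (\<Sum>k\<in>S. (cmod (c k))\<^sup>2))"
    by (simp add: sum_distrib_left complex_norm_square algebra_simps del: of_real_power)
  finally show ?thesis
    unfolding P_def by (simp only: of_real_eq_iff)
qed

text \<open>
  Here \<open>P\<close> is the Fourier polynomial of \<open>f\<close> without the normalising factor \<open>r\<^bsup>-n\<^esup>\<close>; expanding
  \<open>0 \<le> \<integral> |f - r\<^bsup>-n\<^esup> P|\<^sup>2\<close> gives the inequality.
\<close>

lemma bessel_inequality_cell:
  fixes f :: "real ^ 'n \<Rightarrow> complex"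
  assumes r: "0 < r" and S: "finite S"
    and [measurable]: "f \<in> borel_measurable borel"
    and f: "integrable (cell_measure a r) (\<lambda>x. (cmod (f x))\<^sup>2)"
  shows "(\<Sum>m\<in>S. (cmod (\<integral>x. f x * cnj (lattice_char r m x) \<partial>cell_measure a r))\<^sup>2)
    \<le> r ^ CARD('n) * (\<integral>x. (cmod (f x))\<^sup>2 \<partial>cell_measure a r)"
proof -
  define \<mu> where "\<mu> = (cell_measure a r :: (real ^ 'n) measure)"
  define c where "c m = (\<integral>x. f x * cnj (lattice_char r m x) \<partial>\<mu>)" for m
  define P where "P x = (\<Sum>k\<in>S. c k * lattice_char r k x)" for x
  define s where "s = (\<Sum>k\<in>S. (cmod (c k))\<^sup>2)"
  define R where "R = r ^ CARD('n)"
  have R: "0 < R" using r by (simp add: R_def)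
  have [measurable]: "P \<in> borel_measurable borel"
    unfolding P_def by measurable
  interpret finite_measure \<mu>
    unfolding \<mu>_def using r by (intro finite_cell_measure) simp
  have fint: "integrable \<mu> f"
  proof (rule square_integrable_imp_integrable)
    have "integrable \<mu> (\<lambda>x. norm ((f x)\<^sup>2))"
      using f by (simp add: \<mu>_def norm_power)
    then show "integrable \<mu> (\<lambda>x. (f x)\<^sup>2)"
      by (rule integrable_norm_cancel) (simp add: \<mu>_def)
  qed (simp add: \<mu>_def)
  have fE: "integrable \<mu> (\<lambda>x. f x * cnj (lattice_char r m x))" for m
    by (rule Bochner_Integration.integrable_bound[OF fint]) (auto simp: \<mu>_def norm_mult)
  have P2: "integrable \<mu> (\<lambda>x. (cmod (P x))\<^sup>2)"
    unfolding \<mu>_def P_def using r trig_poly_bound[of c r _ S]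
    by (intro integrable_cell_bounded[where B = "(\<Sum>k\<in>S. cmod (c k))\<^sup>2"]) (auto intro!: power_mono)
  have fP_eq: "f x * cnj (P x) = (\<Sum>m\<in>S. cnj (c m) * (f x * cnj (lattice_char r m x)))" for x
    by (simp add: P_def sum_distrib_left algebra_simps)
  have fP: "integrable \<mu> (\<lambda>x. f x * cnj (P x))"
    unfolding fP_eq using fE by simp
  have "(\<integral>x. f x * cnj (P x) \<partial>\<mu>) = (\<Sum>m\<in>S. cnj (c m) * c m)"
    unfolding fP_eq c_def using fE by simp
  also have "\<dots> = complex_of_real s"
    by (simp add: s_def complex_norm_square algebra_simps del: of_real_power)
  finally have ReP: "(\<integral>x. Re (f x * cnj (P x)) \<partial>\<mu>) = s"
    using integral_Re[OF fP] by simp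
  have PP: "(\<integral>x. (cmod (P x))\<^sup>2 \<partial>\<mu>) = R * s"
    unfolding P_def \<mu>_def s_def R_def by (rule trig_poly_parseval[OF r S])
  define t where "t = 1 / R"
  have tR: "t * R = 1" "0 < t" using R by (simp_all add: t_def)
  have sq: "(cmod (f x - t * P x))\<^sup>2
      = (cmod (f x))\<^sup>2 - 2 * t * Re (f x * cnj (P x)) + t\<^sup>2 * (cmod (P x))\<^sup>2" for x
    unfolding cmod_power2 by (simp add: algebra_simps power2_eq_square)
  have "0 \<le> (\<integral>x. (cmod (f x - t * P x))\<^sup>2 \<partial>\<mu>)"
    by simp
  also have "\<dots> = (\<integral>x. (cmod (f x))\<^sup>2 \<partial>\<mu>) - 2 * t * s + t\<^sup>2 * (R * s)"
    unfolding sq using f P2 integrable_Re[OF fP] by (simp add: ReP[simplified] PP \<mu>_def[symmetric])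
  also have "t\<^sup>2 * (R * s) = (t * R) * (t * s)"
    by (simp add: power2_eq_square)
  also have "\<dots> = t * s"
    by (simp add: tR)
  finally have "t * s \<le> (\<integral>x. (cmod (f x))\<^sup>2 \<partial>\<mu>)"
    by (simp add: mult.commute)
  then have "R * (t * s) \<le> R * (\<integral>x. (cmod (f x))\<^sup>2 \<partial>\<mu>)"
    using R by (intro mult_left_mono) auto
  then have "s \<le> R * (\<integral>x. (cmod (f x))\<^sup>2 \<partial>\<mu>)"
    using R by (simp add: t_def)
  then show ?thesis
    by (simp add: s_def c_def \<mu>_def R_def)
qed

section \<open>The upper half of Plancherel's theorem\<close>

lemma borel_measurable_cis [measurable (raw)]:
  "f \<in> borel_measurable M \<Longrightarrow> (\<lambda>x. cis (f x)) \<in> borel_measurable M"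
  by (rule measurable_compose[of f M borel cis])
     (auto intro!: borel_measurable_continuous_onI continuous_intros)

lemma nn_integral_count_space_has_sum:
  fixes f :: "'a \<Rightarrow> real"
  assumes "(f has_sum s) UNIV" "\<And>x. 0 \<le> f x"
  shows "(\<integral>\<^sup>+x. ennreal (f x) \<partial>count_space UNIV) = ennreal s"
proof -
  have "(\<lambda>x. norm (f x)) summable_on UNIV"
    using assms has_sum_imp_summable by auto
  then have abs: "Infinite_Set_Sum.abs_summable_on f UNIV"
    using abs_summable_equivalent by blast
  then have "(\<integral>\<^sup>+x. ennreal (f x) \<partial>count_space UNIV) = ennreal (infsetsum f UNIV)"
    using assms(2) by (intro nn_integral_conv_infsetsum) auto
  then show ?thesis
    using infsetsum_infsum[OF abs] infsumI[OF assms(1)] by simp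
qed

lemma nn_integral_count_space_le:
  fixes f :: "'a \<Rightarrow> real"
  assumes "\<And>S. finite S \<Longrightarrow> (\<Sum>x\<in>S. f x) \<le> C" "\<And>x. 0 \<le> f x"
  shows "(\<integral>\<^sup>+x. ennreal (f x) \<partial>count_space UNIV) \<le> ennreal C"
proof -
  have "f summable_on UNIV"
    using assms by (intro nonneg_bdd_above_summable_on) (auto intro!: bdd_aboveI)
  then have "(\<integral>\<^sup>+x. ennreal (f x) \<partial>count_space UNIV) = ennreal (infsum f UNIV)" "infsum f UNIV \<le> C"
    using assms by (auto intro!: nn_integral_count_space_has_sum infsum_le_finite_sums)
  then show ?thesis by (simp add: ennreal_leI)
qed

lemma bessel_inequality_count_space:
  fixes f :: "real ^ 'n \<Rightarrow> complex"
  assumes r: "0 < r" and [measurable]: "f \<in> borel_measurable borel"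
  shows "(\<integral>\<^sup>+m. ennreal ((cmod (\<integral>x. f x * cnj (lattice_char r m x) \<partial>cell_measure a r))\<^sup>2) \<partial>count_space UNIV)
    \<le> ennreal (r ^ CARD('n)) * (\<integral>\<^sup>+x\<in>cell a r. ennreal ((cmod (f x))\<^sup>2) \<partial>lborel)"
proof (cases "(\<integral>\<^sup>+x\<in>cell a r. ennreal ((cmod (f x))\<^sup>2) \<partial>lborel) = \<infinity>")
  case True
  then show ?thesis using r by (simp add: ennreal_mult_eq_top_iff)
next
  case False
  have eq: "(\<integral>\<^sup>+x\<in>cell a r. ennreal ((cmod (f x))\<^sup>2) \<partial>lborel)
      = (\<integral>\<^sup>+x. ennreal ((cmod (f x))\<^sup>2) \<partial>cell_measure a r)"
    by (simp add: nn_integral_restrict_space)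
  have int: "integrable (cell_measure a r) (\<lambda>x. (cmod (f x))\<^sup>2)"
    using False unfolding eq by (intro integrableI_nonneg) (auto simp: less_top)
  have "(\<integral>\<^sup>+m. ennreal ((cmod (\<integral>x. f x * cnj (lattice_char r m x) \<partial>cell_measure a r))\<^sup>2) \<partial>count_space UNIV)
    \<le> ennreal (r ^ CARD('n) * (\<integral>x. (cmod (f x))\<^sup>2 \<partial>cell_measure a r))"
    by (intro nn_integral_count_space_le bessel_inequality_cell[OF r] int) auto
  also have "\<dots> = ennreal (r ^ CARD('n)) * (\<integral>\<^sup>+x. ennreal ((cmod (f x))\<^sup>2) \<partial>cell_measure a r)"
    using r by (subst nn_integral_eq_integral[OF int]) (auto simp: ennreal_mult)
  finally show ?thesis unfolding eq .
qed

text \<open>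
  Split the frequency \<open>s\<close> as \<open>t + m / r\<close> with \<open>t\<close> in a cell of side \<open>1 / r\<close>. As \<open>f\<close> lives on a cell
  of side \<open>r\<close>, the values of its transform at these frequencies are, for fixed \<open>t\<close>, the Fourier
  coefficients of \<open>f(x) e\<^bsup>2\<pi>i x\<cdot>t\<^esup>\<close> on that cell. Bessel's inequality costs the volume \<open>r\<^sup>n\<close> of the
  one cell, and the integration over \<open>t\<close> gains the volume \<open>r\<^bsup>-n\<^esup>\<close> of the other.
\<close>

lemma plancherel_inequality_cell_support:
  fixes f :: "real ^ 'n \<Rightarrow> complex"
  assumes r: "0 < r" and [measurable]: "f \<in> borel_measurable borel"
    and supp: "\<And>x. x \<notin> cell a r \<Longrightarrow> f x = 0"
  shows "(\<integral>\<^sup>+s. ennreal ((cmod (\<integral>x. f x * cis (2 * pi * (x \<bullet> s)) \<partial>lborel))\<^sup>2) \<partial>lborel)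
    \<le> (\<integral>\<^sup>+x. ennreal ((cmod (f x))\<^sup>2) \<partial>lborel)"
proof -
  define F where "F s = (\<integral>x. f x * cis (2 * pi * (x \<bullet> s)) \<partial>lborel)" for s
  define I where "I = (\<integral>\<^sup>+x. ennreal ((cmod (f x))\<^sup>2) \<partial>lborel)"
  have [measurable]: "F \<in> borel_measurable borel"
    unfolding F_def by measurable
  have F: "F (t + (1 / r) *\<^sub>R int_vec (- m))
      = (\<integral>x. (f x * cis (2 * pi * (x \<bullet> t))) * cnj (lattice_char r m x) \<partial>cell_measure a r)" for t m
  proof -
    have "F (t + (1 / r) *\<^sub>R int_vec (- m))
        = (\<integral>x. (f x * cis (2 * pi * (x \<bullet> t))) * cnj (lattice_char r m x) \<partial>lborel)"
      by (simp add: F_def lattice_char_def cis_cnj cis_mult inner_diff_right right_diff_distrib mult.assoc)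
    also have "\<dots> = (\<integral>x. indicator (cell a r) x *\<^sub>R ((f x * cis (2 * pi * (x \<bullet> t))) * cnj (lattice_char r m x)) \<partial>lborel)"
      by (intro Bochner_Integration.integral_cong) (auto simp: indicator_def supp)
    finally show ?thesis
      by (simp add: integral_restrict_space)
  qed
  have "(\<integral>\<^sup>+s. ennreal ((cmod (F s))\<^sup>2) \<partial>lborel)
      = (\<integral>\<^sup>+t\<in>cell 0 (1 / r). (\<integral>\<^sup>+m. ennreal ((cmod (F (t + (1 / r) *\<^sub>R int_vec m)))\<^sup>2) \<partial>count_space UNIV) \<partial>lborel)"
    using r by (intro nn_integral_unfold) auto
  also have "\<dots> \<le> (\<integral>\<^sup>+t\<in>cell 0 (1 / r). ennreal (r ^ CARD('n)) * I \<partial>(lborel :: (real ^ 'n) measure))"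
  proof (intro nn_integral_mono mult_right_mono)
    fix t :: "real ^ 'n"
    have "(\<integral>\<^sup>+m. ennreal ((cmod (F (t + (1 / r) *\<^sub>R int_vec m)))\<^sup>2) \<partial>count_space UNIV)
        = (\<integral>\<^sup>+m. ennreal ((cmod (F (t + (1 / r) *\<^sub>R int_vec (- m))))\<^sup>2) \<partial>count_space UNIV)"
      by (rule nn_integral_bij_count_space[symmetric, OF bij_uminus])
    also have "\<dots> \<le> ennreal (r ^ CARD('n)) *
        (\<integral>\<^sup>+x\<in>cell a r. ennreal ((cmod (f x * cis (2 * pi * (x \<bullet> t))))\<^sup>2) \<partial>lborel)"
      unfolding F by (rule bessel_inequality_count_space[OF r]) measurable
    also have "(\<integral>\<^sup>+x\<in>cell a r. ennreal ((cmod (f x * cis (2 * pi * (x \<bullet> t))))\<^sup>2) \<partial>lborel) = I"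
      unfolding I_def by (intro nn_integral_cong) (auto simp: norm_mult indicator_def supp)
    finally show "(\<integral>\<^sup>+m. ennreal ((cmod (F (t + (1 / r) *\<^sub>R int_vec m)))\<^sup>2) \<partial>count_space UNIV)
        \<le> ennreal (r ^ CARD('n)) * I" .
  qed simp
  also have "\<dots> = ennreal (r ^ CARD('n)) * ennreal ((1 / r) ^ CARD('n)) * I"
    using r by (simp add: nn_integral_cmult emeasure_cell mult.assoc mult.commute mult.left_commute)
  also have "\<dots> = I"
    using r by (simp add: ennreal_mult[symmetric] power_mult_distrib[symmetric])
  finally show ?thesis
    by (simp add: F_def I_def)
qed

lemma borel_measurable_fst_snd [measurable (raw)]:
  fixes f :: "'c \<Rightarrow> 'a::second_countable_topology \<times> 'b::second_countable_topology"
  assumes "f \<in> borel_measurable M"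
  shows "(\<lambda>x. fst (f x)) \<in> borel_measurable M" "(\<lambda>x. snd (f x)) \<in> borel_measurable M"
  by (rule measurable_compose[OF assms], intro borel_measurable_continuous_onI continuous_intros)+

lemma nn_integral_lborel_pair:
  fixes h :: "'a::euclidean_space \<times> 'b::euclidean_space \<Rightarrow> ennreal"
  assumes "h \<in> borel_measurable borel"
  shows "(\<integral>\<^sup>+z. h z \<partial>lborel) = (\<integral>\<^sup>+x. (\<integral>\<^sup>+y. h (x, y) \<partial>lborel) \<partial>lborel)"
    "(\<integral>\<^sup>+z. h z \<partial>lborel) = (\<integral>\<^sup>+y. (\<integral>\<^sup>+x. h (x, y) \<partial>lborel) \<partial>lborel)"
proof -
  have h: "h \<in> borel_measurable (lborel \<Otimes>\<^sub>M lborel)"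
    using assms by (simp add: lborel_prod)
  show "(\<integral>\<^sup>+z. h z \<partial>lborel) = (\<integral>\<^sup>+x. (\<integral>\<^sup>+y. h (x, y) \<partial>lborel) \<partial>lborel)"
    by (subst lborel_prod[symmetric], rule lborel.nn_integral_fst[OF h, symmetric])
  show "(\<integral>\<^sup>+z. h z \<partial>lborel) = (\<integral>\<^sup>+y. (\<integral>\<^sup>+x. h (x, y) \<partial>lborel) \<partial>lborel)"
    by (subst lborel_prod[symmetric], rule lborel_pair.nn_integral_snd[symmetric]) (use h in simp)
qed

lemma nn_integral_lborel_shear:
  fixes h :: "'a::euclidean_space \<times> 'a \<Rightarrow> ennreal"
  assumes [measurable]: "h \<in> borel_measurable borel"
  shows "(\<integral>\<^sup>+z. h z \<partial>lborel) = (\<integral>\<^sup>+y. (\<integral>\<^sup>+\<xi>. h (\<xi>, y + \<xi>) \<partial>lborel) \<partial>lborel)"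
proof -
  have "(\<integral>\<^sup>+z. h z \<partial>lborel) = (\<integral>\<^sup>+\<xi>. (\<integral>\<^sup>+y. h (\<xi>, y) \<partial>lborel) \<partial>lborel)"
    by (rule nn_integral_lborel_pair) simp
  also have "\<dots> = (\<integral>\<^sup>+\<xi>. (\<integral>\<^sup>+y. h (\<xi>, y + \<xi>) \<partial>lborel) \<partial>lborel)"
    by (subst nn_integral_lborel_translate) auto
  also have "\<dots> = (\<integral>\<^sup>+z. h (fst z, snd z + fst z) \<partial>lborel)"
    by (subst nn_integral_lborel_pair(1)) auto
  also have "\<dots> = (\<integral>\<^sup>+y. (\<integral>\<^sup>+\<xi>. h (\<xi>, y + \<xi>) \<partial>lborel) \<partial>lborel)"
    by (subst nn_integral_lborel_pair(2)) auto
  finally show ?thesis .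
qed

section \<open>The Weyl integral\<close>

text \<open>
  The integral defining the kernel, without truncation. It is meaningful for almost every point
  when \<open>f\<close> is square integrable with bounded support in the first variable.
\<close>

definition weyl_integral ::
  "((real ^ 'n) \<times> (real ^ 'n) \<Rightarrow> complex) \<Rightarrow> (real ^ 'n) \<times> (real ^ 'n) \<Rightarrow> complex" where
  "weyl_integral f z = (\<integral>x. f (x, snd z - fst z) * cis (pi * (x \<bullet> (fst z + snd z))) \<partial>lborel)"

lemma weyl_integral_measurable [measurable]:
  assumes [measurable]: "f \<in> borel_measurable borel"
  shows "weyl_integral f \<in> borel_measurable borel"
  unfolding weyl_integral_def by measurable

text \<open>
  With \<open>\<eta> = \<xi> + y\<close> the kernel becomes, for fixed \<open>y\<close>, the Fourier transform at \<open>\<xi>\<close> of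
  \<open>x \<mapsto> f(x, y) e\<^bsup>\<pi>i x\<cdot>y\<^esup>\<close>, which has the same modulus as \<open>f(\<cdot>, y)\<close>.
\<close>

lemma weyl_integral_bound:
  fixes f :: "(real ^ 'n) \<times> (real ^ 'n) \<Rightarrow> complex"
  assumes r: "0 < r" and [measurable]: "f \<in> borel_measurable borel"
    and supp: "\<And>x y. x \<notin> cell a r \<Longrightarrow> f (x, y) = 0"
  shows "(\<integral>\<^sup>+z. ennreal ((cmod (weyl_integral f z))\<^sup>2) \<partial>lborel) \<le> (\<integral>\<^sup>+z. ennreal ((cmod (f z))\<^sup>2) \<partial>lborel)"
proof -
  have eq: "weyl_integral f (\<xi>, y + \<xi>)
      = (\<integral>x. (f (x, y) * cis (pi * (x \<bullet> y))) * cis (2 * pi * (x \<bullet> \<xi>)) \<partial>lborel)" for \<xi> y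
  proof -
    have "pi * (x \<bullet> (\<xi> + (y + \<xi>))) = pi * (x \<bullet> y) + 2 * pi * (x \<bullet> \<xi>)" for x
      unfolding inner_add_right distrib_left by simp
    then show ?thesis
      by (simp add: weyl_integral_def mult.assoc cis_mult)
  qed
  have "(\<integral>\<^sup>+z. ennreal ((cmod (weyl_integral f z))\<^sup>2) \<partial>lborel)
      = (\<integral>\<^sup>+y. (\<integral>\<^sup>+\<xi>. ennreal ((cmod (weyl_integral f (\<xi>, y + \<xi>)))\<^sup>2) \<partial>lborel) \<partial>lborel)"
    by (rule nn_integral_lborel_shear) measurable
  also have "\<dots> \<le> (\<integral>\<^sup>+y. (\<integral>\<^sup>+x. ennreal ((cmod (f (x, y) * cis (pi * (x \<bullet> y))))\<^sup>2) \<partial>lborel) \<partial>lborel)"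
    unfolding eq by (rule nn_integral_mono, rule plancherel_inequality_cell_support[OF r, where a = a]) (auto simp: supp)
  also have "\<dots> = (\<integral>\<^sup>+z. ennreal ((cmod (f z))\<^sup>2) \<partial>lborel)"
    by (subst nn_integral_lborel_pair(2)) (auto simp: norm_mult)
  finally show ?thesis .
qed

section \<open>Square integrable functions\<close>

definition L2sq :: "('a::euclidean_space \<Rightarrow> complex) \<Rightarrow> ennreal" where
  "L2sq f = (\<integral>\<^sup>+z. ennreal ((cmod (f z))\<^sup>2) \<partial>lborel)"

lemma L2_limit_iff: "L2_limit F f \<longleftrightarrow> (\<lambda>N. L2sq (\<lambda>z. F N z - f z)) \<longlonglongrightarrow> 0"
  by (simp add: L2_limit_def L2sq_def nn_integral_completion)

lemma L2sq_cong_AE: "AE z in lborel. f z = g z \<Longrightarrow> L2sq f = L2sq g"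
  unfolding L2sq_def by (rule nn_integral_cong_AE) auto

lemma L2sq_add:
  assumes [measurable]: "f \<in> borel_measurable borel" "g \<in> borel_measurable borel"
  shows "L2sq (\<lambda>z. f z + g z) \<le> 2 * L2sq f + 2 * L2sq g"
proof -
  have *: "(cmod (a + b))\<^sup>2 \<le> 2 * (cmod a)\<^sup>2 + 2 * (cmod b)\<^sup>2" for a b
  proof -
    have "(cmod (a + b))\<^sup>2 \<le> (cmod a + cmod b)\<^sup>2"
      by (intro power_mono norm_triangle_ineq) auto
    also have "\<dots> \<le> 2 * (cmod a)\<^sup>2 + 2 * (cmod b)\<^sup>2"
      using sum_squares_bound[of "cmod a" "cmod b"] by (simp add: power2_sum)
    finally show ?thesis .
  qed
  have "L2sq (\<lambda>z. f z + g z) \<le> (\<integral>\<^sup>+z. 2 * ennreal ((cmod (f z))\<^sup>2) + 2 * ennreal ((cmod (g z))\<^sup>2) \<partial>lborel)"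
    unfolding L2sq_def
  proof (rule nn_integral_mono)
    fix z
    have "ennreal ((cmod (f z + g z))\<^sup>2) \<le> ennreal (2 * (cmod (f z))\<^sup>2 + 2 * (cmod (g z))\<^sup>2)"
      by (intro ennreal_leI *)
    also have "\<dots> = 2 * ennreal ((cmod (f z))\<^sup>2) + 2 * ennreal ((cmod (g z))\<^sup>2)"
      by (simp add: ennreal_mult)
    finally show "ennreal ((cmod (f z + g z))\<^sup>2)
      \<le> 2 * ennreal ((cmod (f z))\<^sup>2) + 2 * ennreal ((cmod (g z))\<^sup>2)" .
  qed
  then show ?thesis
    unfolding L2sq_def by (simp add: nn_integral_add nn_integral_cmult)
qed

lemma L2sq_sum:
  assumes [measurable]: "\<And>j. j \<in> J \<Longrightarrow> f j \<in> borel_measurable borel"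
  shows "L2sq (\<lambda>z. \<Sum>j\<in>J. c j * f j z) \<le> (\<Sum>j\<in>J. ennreal (card J * (cmod (c j))\<^sup>2) * L2sq (f j))"
proof -
  have "L2sq (\<lambda>z. \<Sum>j\<in>J. c j * f j z)
      \<le> (\<integral>\<^sup>+z. (\<Sum>j\<in>J. ennreal (card J * (cmod (c j))\<^sup>2) * ennreal ((cmod (f j z))\<^sup>2)) \<partial>lborel)"
    unfolding L2sq_def
  proof (rule nn_integral_mono)
    fix z
    have "(cmod (\<Sum>j\<in>J. c j * f j z))\<^sup>2 \<le> (\<Sum>j\<in>J. cmod (c j * f j z))\<^sup>2"
      by (intro power_mono norm_sum) auto
    also have "\<dots> \<le> (\<Sum>j\<in>J. (cmod (c j * f j z))\<^sup>2) * card J"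
      by (rule sum_squared_le_sum_of_squares)
    also have "\<dots> = (\<Sum>j\<in>J. card J * (cmod (c j))\<^sup>2 * (cmod (f j z))\<^sup>2)"
      by (simp add: sum_distrib_right sum_distrib_left norm_mult power_mult_distrib ac_simps)
    finally have "ennreal ((cmod (\<Sum>j\<in>J. c j * f j z))\<^sup>2)
        \<le> ennreal (\<Sum>j\<in>J. card J * (cmod (c j))\<^sup>2 * (cmod (f j z))\<^sup>2)"
      by (rule ennreal_leI)
    then show "ennreal ((cmod (\<Sum>j\<in>J. c j * f j z))\<^sup>2)
        \<le> (\<Sum>j\<in>J. ennreal (card J * (cmod (c j))\<^sup>2) * ennreal ((cmod (f j z))\<^sup>2))"
      by (simp add: ennreal_mult sum_ennreal[symmetric])
  qed
  then show ?thesis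
    unfolding L2sq_def by (simp add: nn_integral_sum nn_integral_cmult)
qed

text \<open>
  The weights make the terms \<open>D k\<close> decay geometrically. Applied pointwise to the increments of a
  rapidly Cauchy subsequence, this gives almost everywhere convergence.
\<close>

lemma summable_of_weighted_squares:
  fixes D :: "nat \<Rightarrow> complex"
  assumes "(\<Sum>k. ennreal (2 ^ k * (cmod (D k))\<^sup>2)) < \<infinity>"
  shows "summable D"
proof -
  obtain g where g: "(\<Sum>k. ennreal (2 ^ k * (cmod (D k))\<^sup>2)) = ennreal g" "0 \<le> g"
    using assms by (auto simp: less_top_ennreal)
  have bound: "cmod (D k) \<le> sqrt g * sqrt (1 / 2) ^ k" for k
  proof -
    define u where "u k = ennreal (2 ^ k * (cmod (D k))\<^sup>2)" for k
    have "sum u {k} \<le> suminf u"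
      by (rule sum_le_suminf) auto
    then have "ennreal (2 ^ k * (cmod (D k))\<^sup>2) \<le> ennreal g"
      unfolding g(1)[symmetric] u_def by (simp only: sum.insert sum.empty finite.emptyI empty_iff add_0_right not_False_eq_True)
    then have "2 ^ k * (cmod (D k))\<^sup>2 \<le> g"
      using g(2) by simp
    then have "(cmod (D k))\<^sup>2 \<le> g * (1 / 2) ^ k"
      by (simp add: field_simps power_one_over)
    then have "cmod (D k) \<le> sqrt (g * (1 / 2) ^ k)"
      by (rule real_le_rsqrt)
    then show ?thesis by (simp add: real_sqrt_mult real_sqrt_power)
  qed
  have "summable (\<lambda>k. sqrt g * sqrt (1 / 2) ^ k)"
    by (intro summable_mult summable_geometric) simp
  then show ?thesis
    by (rule summable_comparison_test') (rule bound)
qed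

text \<open>
  Along a subsequence with increments of squared norm at most \<open>4\<^bsup>-k\<^esup>\<close> the functions converge almost
  everywhere. Fatou's lemma shows that the pointwise limit is the \<open>L\<^sup>2\<close> limit of the whole
  sequence.
\<close>

lemma L2_complete:
  fixes F :: "nat \<Rightarrow> 'a::euclidean_space \<Rightarrow> complex"
  assumes [measurable]: "\<And>n. F n \<in> borel_measurable borel"
    and tail: "\<And>m n. n \<le> m \<Longrightarrow> L2sq (\<lambda>z. F m z - F n z) \<le> t n"
    and t: "t \<longlonglongrightarrow> 0"
  obtains K where "K \<in> borel_measurable borel" "(\<lambda>n. L2sq (\<lambda>z. F n z - K z)) \<longlonglongrightarrow> 0"
proof -
  have ex: "\<exists>n. m < n \<and> t n \<le> ennreal ((1 / 4) ^ k)" for k m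
  proof -
    have "\<forall>\<^sub>F n in sequentially. t n < ennreal ((1 / 4) ^ k)"
      using t by (rule order_tendstoD) simp
    then have "\<forall>\<^sub>F n in sequentially. m < n \<and> t n \<le> ennreal ((1 / 4) ^ k)"
      using eventually_gt_at_top[of m] by eventually_elim (simp add: less_imp_le)
    then show ?thesis
      by (rule eventually_happens'[OF sequentially_bot])
  qed
  obtain r where tr: "\<And>k. t (r k) \<le> ennreal ((1 / 4) ^ k)" and rSuc: "\<And>k. r k < r (Suc k)"
  proof -
    have "\<exists>r. \<forall>k. t (r k) \<le> ennreal ((1 / 4) ^ k) \<and> r k < r (Suc k)"
      using ex by (intro dependent_nat_choice) blast+
    then show thesis using that by blast
  qed
  have r: "strict_mono r"
    using rSuc by (simp add: strict_mono_Suc_iff)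
  define D where "D k z = F (r (Suc k)) z - F (r k) z" for k z
  have [measurable]: "D k \<in> borel_measurable borel" for k
    unfolding D_def by measurable
  have D: "L2sq (D k) \<le> ennreal ((1 / 4) ^ k)" for k
    unfolding D_def by (rule order_trans[OF tail tr]) (use rSuc[of k] in simp)
  have "(\<integral>\<^sup>+z. (\<Sum>k. ennreal (2 ^ k * (cmod (D k z))\<^sup>2)) \<partial>lborel)
      = (\<Sum>k. ennreal (2 ^ k) * L2sq (D k))"
    unfolding L2sq_def by (simp add: nn_integral_suminf nn_integral_cmult ennreal_mult)
  also have "\<dots> \<le> (\<Sum>k. ennreal ((1 / 2) ^ k))"
  proof (rule suminf_le)
    fix k
    have "ennreal (2 ^ k) * L2sq (D k) \<le> ennreal (2 ^ k) * ennreal ((1 / 4) ^ k)"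
      by (intro mult_left_mono D) auto
    also have "\<dots> = ennreal ((1 / 2) ^ k)"
      by (simp add: ennreal_mult[symmetric] power_mult_distrib[symmetric])
    finally show "ennreal (2 ^ k) * L2sq (D k) \<le> ennreal ((1 / 2) ^ k)" .
  qed auto
  also have "\<dots> = ennreal (\<Sum>k. (1 / 2) ^ k)"
    by (intro suminf_ennreal2 summable_geometric) auto
  finally have "(\<integral>\<^sup>+z. (\<Sum>k. ennreal (2 ^ k * (cmod (D k z))\<^sup>2)) \<partial>lborel) \<noteq> \<infinity>"
    by (auto simp: top_unique)
  then have "AE z in lborel. (\<Sum>k. ennreal (2 ^ k * (cmod (D k z))\<^sup>2)) \<noteq> \<infinity>"
    by (intro nn_integral_PInf_AE) auto
  then have conv: "AE z in lborel. convergent (\<lambda>k. F (r k) z)"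
  proof eventually_elim
    case (elim z)
    then have "summable (\<lambda>k. D k z)"
      by (intro summable_of_weighted_squares) (simp add: less_top)
    then have "convergent (\<lambda>n. F (r 0) z + (\<Sum>k<n. D k z))"
      by (auto simp: summable_iff_convergent intro!: convergent_add convergent_const)
    moreover have "F (r 0) z + (\<Sum>k<n. D k z) = F (r n) z" for n
      using sum_lessThan_telescope[of "\<lambda>k. F (r k) z" n] by (simp add: D_def)
    ultimately show ?case by simp
  qed
  define K where "K z = lim (\<lambda>k. F (r k) z)" for z
  have [measurable]: "K \<in> borel_measurable borel"
    unfolding K_def by measurable
  have bound: "L2sq (\<lambda>z. F n z - K z) \<le> t n" for n
  proof -
    have "L2sq (\<lambda>z. F n z - K z) = (\<integral>\<^sup>+z. liminf (\<lambda>k. ennreal ((cmod (F n z - F (r k) z))\<^sup>2)) \<partial>lborel)"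
      unfolding L2sq_def
    proof (rule nn_integral_cong_AE, use conv in eventually_elim)
      case (elim z)
      then have "(\<lambda>k. F (r k) z) \<longlonglongrightarrow> K z"
        by (simp add: K_def convergent_LIMSEQ_iff)
      then have "(\<lambda>k. ennreal ((cmod (F n z - F (r k) z))\<^sup>2)) \<longlonglongrightarrow> ennreal ((cmod (F n z - K z))\<^sup>2)"
        by (intro tendsto_intros)
      then show ?case
        by (rule lim_imp_Liminf[OF sequentially_bot, symmetric])
    qed
    also have "\<dots> \<le> liminf (\<lambda>k. L2sq (\<lambda>z. F n z - F (r k) z))"
      unfolding L2sq_def by (rule nn_integral_liminf) measurable
    also have "\<dots> \<le> limsup (\<lambda>k. L2sq (\<lambda>z. F n z - F (r k) z))"
      by (rule Liminf_le_Limsup) simp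
    also have "\<dots> \<le> t n"
    proof (rule Limsup_bounded)
      show "\<forall>\<^sub>F k in sequentially. L2sq (\<lambda>z. F n z - F (r k) z) \<le> t n"
        using eventually_ge_at_top[of n]
      proof eventually_elim
        case (elim k)
        then have "n \<le> r k" using seq_suble[OF r, of k] by simp
        then show ?case using tail[of n "r k"] by (simp add: L2sq_def norm_minus_commute)
      qed
    qed
    finally show ?thesis .
  qed
  have "(\<lambda>n. L2sq (\<lambda>z. F n z - K z)) \<longlonglongrightarrow> 0"
    by (rule tendsto_sandwich[OF _ _ tendsto_const t]) (auto simp: bound)
  then show thesis
    by (intro that[of K]) auto
qed

lemma AE_lborel_null_cover:
  assumes "AE x in lborel. P x"
  obtains N where "N \<in> sets borel" "AE x in lborel. x \<notin> N" "\<And>x. x \<notin> N \<Longrightarrow> P x"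
proof -
  from assms obtain N where N: "{x \<in> space lborel. \<not> P x} \<subseteq> N" "emeasure lborel N = 0" "N \<in> sets lborel"
    by (rule AE_E)
  then have "AE x in lborel. x \<notin> N"
    by (intro AE_not_in) (auto simp: null_sets_def)
  with N show thesis by (intro that[of N]) auto
qed

lemma AE_lborel_pair:
  fixes P :: "'a::euclidean_space \<times> 'b::euclidean_space \<Rightarrow> bool"
  assumes "AE z in lborel. P z"
  shows "AE x in lborel. AE y in lborel. P (x, y)" "AE y in lborel. AE x in lborel. P (x, y)"
proof -
  show "AE x in lborel. AE y in lborel. P (x, y)"
    by (rule lborel_pair.AE_pair[unfolded lborel_prod, OF assms])
  obtain N where [measurable]: "N \<in> sets borel" and N: "AE z in lborel. z \<notin> N" "\<And>z. z \<notin> N \<Longrightarrow> P z"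
    using AE_lborel_null_cover[OF assms] by blast
  have "(\<integral>\<^sup>+z. indicator N z \<partial>lborel) = 0"
    using N(1) by (subst nn_integral_0_iff_AE) (auto simp: indicator_eq_0_iff)
  then have "(\<integral>\<^sup>+y. (\<integral>\<^sup>+x. indicator N (x, y) \<partial>lborel) \<partial>lborel) = 0"
    by (subst (asm) nn_integral_lborel_pair(2)) auto
  then have "AE y in lborel. (\<integral>\<^sup>+x. indicator N (x, y) \<partial>lborel) = 0"
    by (subst (asm) nn_integral_0_iff_AE) auto
  then show "AE y in lborel. AE x in lborel. P (x, y)"
  proof eventually_elim
    case (elim y)
    then have "AE x in lborel. indicator N (x, y) = (0 :: ennreal)"
      by (subst (asm) nn_integral_0_iff_AE) auto
    then show ?case
      by eventually_elim (use N(2) in \<open>auto simp: indicator_eq_0_iff\<close>)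
  qed
qed

text \<open>
  The kernel at \<open>(\<xi>, \<eta>)\<close> depends on the slice of the function at height \<open>\<eta> - \<xi>\<close>. The shear
  \<open>(\<xi>, y) \<mapsto> (\<xi>, y + \<xi>)\<close> preserves measure, so slices that misbehave on a null set of heights affect
  only a null set of \<open>(\<xi>, \<eta>)\<close>.
\<close>

lemma AE_lborel_difference:
  fixes P :: "'a::euclidean_space \<Rightarrow> bool"
  assumes "AE y in lborel. P y"
  shows "AE z in lborel. P (snd z - fst z)"
proof -
  obtain N where [measurable]: "N \<in> sets borel" and N: "AE y in lborel. y \<notin> N" "\<And>y. y \<notin> N \<Longrightarrow> P y"
    using AE_lborel_null_cover[OF assms] by blast
  have "(\<integral>\<^sup>+z. indicator N (snd z - fst z) \<partial>lborel) = (\<integral>\<^sup>+y. (\<integral>\<^sup>+\<xi>. indicator N y \<partial>(lborel :: 'a measure)) \<partial>lborel)"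
    by (subst nn_integral_lborel_shear) auto
  also have "\<dots> = 0"
    using N(1) by (subst nn_integral_0_iff_AE) (auto elim!: eventually_mono)
  finally have "AE z in lborel. indicator N (snd z - fst z) = (0 :: ennreal)"
    by (subst (asm) nn_integral_0_iff_AE) auto
  then show ?thesis
    by eventually_elim (use N(2) in \<open>auto simp: indicator_eq_0_iff\<close>)
qed

section \<open>Weyl integrals of truncated functions and their translates\<close>

definition x_truncate :: "nat \<Rightarrow> ('a::euclidean_space \<times> 'b::euclidean_space \<Rightarrow> complex) \<Rightarrow> 'a \<times> 'b \<Rightarrow> complex" where
  "x_truncate n f z = (if norm (fst z) \<le> real n then f z else 0)"

lemma x_truncate_measurable [measurable]:
  assumes [measurable]: "f \<in> borel_measurable borel"
  shows "x_truncate n f \<in> borel_measurable borel"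
  unfolding x_truncate_def by measurable

lemma L2sq_x_truncate_tail:
  assumes [measurable]: "f \<in> borel_measurable borel" and fin: "L2sq f < \<infinity>"
  shows "(\<lambda>n. L2sq (\<lambda>z. f z - x_truncate n f z)) \<longlonglongrightarrow> 0"
proof -
  have "(\<lambda>n. \<integral>\<^sup>+z. ennreal ((cmod (f z - x_truncate n f z))\<^sup>2) \<partial>lborel) \<longlonglongrightarrow> (\<integral>\<^sup>+z. 0 \<partial>(lborel :: ('a \<times> 'b) measure))"
  proof (rule nn_integral_dominated_convergence[where w = "\<lambda>z. ennreal ((cmod (f z))\<^sup>2)"])
    show "AE z in lborel. (\<lambda>n. ennreal ((cmod (f z - x_truncate n f z))\<^sup>2)) \<longlonglongrightarrow> 0"
    proof (rule AE_I2)
      fix z :: "'a \<times> 'b"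
      obtain m where m: "norm (fst z) \<le> real m" using real_arch_simple by blast
      have "\<forall>\<^sub>F n in sequentially. ennreal ((cmod (f z - x_truncate n f z))\<^sup>2) = 0"
        using eventually_ge_at_top[of m]
        by eventually_elim (use m in \<open>auto simp: x_truncate_def\<close>)
      then show "(\<lambda>n. ennreal ((cmod (f z - x_truncate n f z))\<^sup>2)) \<longlonglongrightarrow> 0"
        by (rule tendsto_eventually)
    qed
  qed (use fin in \<open>auto simp: x_truncate_def L2sq_def\<close>)
  then show ?thesis by (simp add: L2sq_def)
qed

lemma weyl_integral_L2sq_le:
  fixes f :: "(real ^ 'n) \<times> (real ^ 'n) \<Rightarrow> complex"
  assumes f: "f \<in> borel_measurable borel" and supp: "\<And>x y. B < norm x \<Longrightarrow> f (x, y) = 0"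
  shows "L2sq (weyl_integral f) \<le> L2sq f"
proof -
  define b where "b = \<bar>B\<bar> + 1"
  have "x \<in> cell (- b) (2 * b)" if x: "norm x \<le> B" for x :: "real ^ 'n"
  proof -
    have "- b \<le> x $ i \<and> x $ i < - b + 2 * b" for i
      using component_le_norm_cart[of x i] x by (simp add: b_def) linarith
    then show ?thesis by (simp add: cell_def)
  qed
  then have "f (x, y) = 0" if "x \<notin> cell (- b) (2 * b)" for x y
    using that supp[of x y] by (cases "norm x \<le> B") auto
  then show ?thesis
    unfolding L2sq_def using f by (intro weyl_integral_bound[where r = "2 * b" and a = "- b"]) (auto simp: b_def)
qed

lemma AE_weyl_integrable:
  fixes f :: "(real ^ 'n) \<times> (real ^ 'n) \<Rightarrow> complex"
  assumes [measurable]: "f \<in> borel_measurable borel" and supp: "\<And>x y. B < norm x \<Longrightarrow> f (x, y) = 0"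
    and fin: "L2sq f < \<infinity>"
  shows "AE z in lborel. integrable lborel (\<lambda>x. f (x, snd z - fst z) * cis (pi * (x \<bullet> (fst z + snd z))))"
proof -
  have "(\<integral>\<^sup>+y. (\<integral>\<^sup>+x. ennreal ((cmod (f (x, y)))\<^sup>2) \<partial>lborel) \<partial>lborel) \<noteq> \<infinity>"
    using fin unfolding L2sq_def by (subst (asm) nn_integral_lborel_pair(2)) auto
  then have "AE y in lborel. (\<integral>\<^sup>+x. ennreal ((cmod (f (x, y)))\<^sup>2) \<partial>lborel) \<noteq> \<infinity>"
    by (intro nn_integral_PInf_AE) auto
  then have "AE y in lborel. integrable lborel (\<lambda>x. f (x, y))"
  proof eventually_elim
    case (elim y)
    then have sq: "integrable lborel (\<lambda>x. (cmod (f (x, y)))\<^sup>2)"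
      by (intro integrableI_nonneg) (auto simp: less_top)
    have ind: "integrable lborel (indicator (cball 0 B) :: real ^ 'n \<Rightarrow> real)"
      by (intro integrable_real_indicator) (use emeasure_lborel_cball_finite[of "0 :: real ^ 'n" B] in auto)
    show ?case
    proof (rule Bochner_Integration.integrable_bound[OF Bochner_Integration.integrable_add[OF ind sq]])
      \<comment> \<open>on a set of finite measure, square integrable functions are integrable, because \<open>t \<le> 1 + t\<^sup>2\<close>\<close>
      have "cmod (f (x, y)) \<le> indicator (cball 0 B) x + (cmod (f (x, y)))\<^sup>2" for x
      proof (cases "norm x \<le> B")
        case True
        have "cmod (f (x, y)) \<le> 1 + (cmod (f (x, y)))\<^sup>2"
          using zero_le_power2[of "cmod (f (x, y)) - 1"] norm_ge_zero[of "f (x, y)"]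
          unfolding power2_diff one_power2 mult_1_right by linarith
        then show ?thesis using True by simp
      qed (simp add: supp)
      then show "AE x in lborel. norm (f (x, y)) \<le> norm (indicator (cball 0 B) x + (cmod (f (x, y)))\<^sup>2)"
        by (auto intro!: AE_I2 intro: order_trans)
    qed simp
  qed
  then have "AE z in lborel. integrable lborel (\<lambda>x. f (x, snd z - fst z))"
    by (rule AE_lborel_difference)
  then show ?thesis
    by eventually_elim (erule Bochner_Integration.integrable_bound, auto simp: norm_mult)
qed

text \<open>
  Linearity can fail where a slice is not integrable, because the integral has the value \<open>0\<close> there;
  these points form a null set.
\<close>

lemma AE_weyl_integral_sum:
  fixes f :: "'j \<Rightarrow> (real ^ 'n) \<times> (real ^ 'n) \<Rightarrow> complex"
  assumes J: "finite J" and f: "\<And>j. j \<in> J \<Longrightarrow> f j \<in> borel_measurable borel"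
    and supp: "\<And>j x y. j \<in> J \<Longrightarrow> B < norm x \<Longrightarrow> f j (x, y) = 0"
    and fin: "\<And>j. j \<in> J \<Longrightarrow> L2sq (f j) < \<infinity>"
  shows "AE z in lborel. weyl_integral (\<lambda>z. \<Sum>j\<in>J. c j * f j z) z = (\<Sum>j\<in>J. c j * weyl_integral (f j) z)"
proof -
  have "AE z in lborel. \<forall>j\<in>J. integrable lborel (\<lambda>x. f j (x, snd z - fst z) * cis (pi * (x \<bullet> (fst z + snd z))))"
    using J AE_weyl_integrable[OF f supp fin] by (intro AE_finite_allI) auto
  then show ?thesis
    by eventually_elim (simp add: weyl_integral_def sum_distrib_right mult.assoc)
qed

text \<open>
  The operator on kernels that corresponds to the twisted translation by \<open>j\<close>, see
  \<open>weyl_integral_twisted_translation\<close>.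
\<close>

definition kernel_translation ::
  "(int ^ 'n) \<times> (int ^ 'n) \<Rightarrow> ((real ^ 'n) \<times> (real ^ 'n) \<Rightarrow> complex) \<Rightarrow> (real ^ 'n) \<times> (real ^ 'n) \<Rightarrow> complex" where
  "kernel_translation j K z = cis (pi * (int_vec (fst j) \<bullet> int_vec (snd j))) *
     lattice_char 1 (fst j) (fst z) * K (fst z + int_vec (snd j), snd z)"

lemma twisted_translation_eq:
  "twisted_translation j f z = cis (pi * (fst z \<bullet> int_vec (snd j) - snd z \<bullet> int_vec (fst j)))
     * f (fst z - int_vec (fst j), snd z - int_vec (snd j))"
  by (simp add: twisted_translation_def split_beta)

lemma twisted_translation_measurable [measurable]:
  assumes [measurable]: "f \<in> borel_measurable borel"
  shows "twisted_translation j f \<in> borel_measurable borel"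
  unfolding twisted_translation_eq by measurable

lemma kernel_translation_measurable [measurable]:
  assumes [measurable]: "K \<in> borel_measurable borel"
  shows "kernel_translation j K \<in> borel_measurable borel"
  unfolding kernel_translation_def by measurable

lemma L2sq_twisted_translation:
  assumes [measurable]: "f \<in> borel_measurable borel"
  shows "L2sq (twisted_translation j f) = L2sq f"
  unfolding L2sq_def
  by (subst (2) nn_integral_lborel_translate[symmetric, where c = "(- int_vec (fst j), - int_vec (snd j))"])
     (auto simp: twisted_translation_eq norm_mult plus_prod_def)

lemma L2sq_kernel_translation:
  assumes [measurable]: "K \<in> borel_measurable borel"
  shows "L2sq (kernel_translation j K) = L2sq K"
  unfolding L2sq_def
  by (subst (2) nn_integral_lborel_translate[symmetric, where c = "(int_vec (snd j), 0)"])
     (auto simp: kernel_translation_def norm_mult plus_prod_def)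

text \<open>
  After the substitution \<open>x \<mapsto> x + k\<close> the phases that do not involve \<open>x\<close> combine to
  \<open>\<pi> k \<cdot> l + 2 \<pi> k \<cdot> \<xi>\<close>, and the shift of the second variable by \<open>l\<close> is absorbed into
  \<open>\<eta> - (\<xi> + l)\<close>.
\<close>

lemma weyl_integral_twisted_translation:
  fixes f :: "(real ^ 'n) \<times> (real ^ 'n) \<Rightarrow> complex"
  assumes [measurable]: "f \<in> borel_measurable borel"
  shows "weyl_integral (twisted_translation j f) z = kernel_translation j (weyl_integral f) z"
proof -
  obtain k l where j: "j = (k, l)" by (cases j)
  obtain \<xi> \<eta> where z: "z = (\<xi>, \<eta>)" by (cases z)
  have phase: "cis (pi * ((x + int_vec k) \<bullet> int_vec l - (\<eta> - \<xi>) \<bullet> int_vec k)) *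
      cis (pi * ((x + int_vec k) \<bullet> (\<xi> + \<eta>)))
    = cis (pi * (int_vec k \<bullet> int_vec l)) * lattice_char 1 k \<xi> * cis (pi * (x \<bullet> (\<xi> + int_vec l + \<eta>)))" for x
    by (simp add: lattice_char_def cis_mult inner_add_left inner_add_right inner_diff_left
        inner_diff_right inner_commute algebra_simps)
  have "weyl_integral (twisted_translation j f) z
      = (\<integral>x. twisted_translation j f (x, \<eta> - \<xi>) * cis (pi * (x \<bullet> (\<xi> + \<eta>))) \<partial>lborel)"
    by (simp add: weyl_integral_def z)
  also have "\<dots> = (\<integral>x. twisted_translation j f (x + int_vec k, \<eta> - \<xi>) *
      cis (pi * ((x + int_vec k) \<bullet> (\<xi> + \<eta>))) \<partial>lborel)"
    by (subst integral_lborel_translate[symmetric, where c = "int_vec k"]) auto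
  also have "\<dots> = (\<integral>x. (cis (pi * (int_vec k \<bullet> int_vec l)) * lattice_char 1 k \<xi>) *
      (f (x, \<eta> - (\<xi> + int_vec l)) * cis (pi * (x \<bullet> (\<xi> + int_vec l + \<eta>)))) \<partial>lborel)"
  proof (rule Bochner_Integration.integral_cong[OF refl])
    fix x
    show "twisted_translation j f (x + int_vec k, \<eta> - \<xi>) * cis (pi * ((x + int_vec k) \<bullet> (\<xi> + \<eta>)))
      = (cis (pi * (int_vec k \<bullet> int_vec l)) * lattice_char 1 k \<xi>) *
        (f (x, \<eta> - (\<xi> + int_vec l)) * cis (pi * (x \<bullet> (\<xi> + int_vec l + \<eta>))))"
      using phase[of x] by (simp add: twisted_translation_eq j diff_diff_eq mult_ac)
  qed
  also have "\<dots> = kernel_translation j (weyl_integral f) z"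
    by (simp add: kernel_translation_def weyl_integral_def j z)
  finally show ?thesis .
qed

section \<open>Existence of the Weyl kernel\<close>

lemma lebesgue_measurable_borel_representative:
  fixes f :: "'a::euclidean_space \<Rightarrow> complex"
  assumes f: "f \<in> borel_measurable lebesgue"
  obtains g where "g \<in> borel_measurable borel" "AE z in lborel. f z = g z"
proof -
  have "(\<lambda>z. Re (f z)) \<in> borel_measurable lebesgue" "(\<lambda>z. Im (f z)) \<in> borel_measurable lebesgue"
    using f by measurable
  note this[THEN completion_ex_borel_measurable_real]
  then obtain u v where "u \<in> borel_measurable lborel" "AE z in lborel. Re (f z) = u z"
    "v \<in> borel_measurable lborel" "AE z in lborel. Im (f z) = v z"
    by blast
  then show thesis
    by (intro that[of "\<lambda>z. Complex (u z) (v z)"])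
       (auto simp: Complex_eq complex_eq_iff elim: eventually_elim2)
qed

lemma lebesgue_integral_borel_representative:
  fixes f g :: "'a::euclidean_space \<Rightarrow> complex"
  assumes g: "g \<in> borel_measurable borel" and eq: "AE x in lborel. f x = g x"
  shows "(\<integral>x. f x \<partial>lebesgue) = (\<integral>x. g x \<partial>lborel)"
proof -
  have ae: "AE x in lebesgue. g x = f x"
    using eq by (intro AE_completion) (auto elim: eventually_mono)
  have gl: "g \<in> borel_measurable lebesgue"
    using g by (intro measurable_completion) simp
  have "(\<integral>x. f x \<partial>lebesgue) = (\<integral>x. g x \<partial>lebesgue)"
    using ae by (intro integral_cong_AE borel_measurable_AE[OF gl ae] gl) (auto elim: eventually_mono)
  also have "\<dots> = (\<integral>x. g x \<partial>lborel)"
    using g by (intro integral_completion) simp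
  finally show ?thesis .
qed

lemma truncated_weyl_kernel_eq_weyl_integral:
  fixes f :: "(real ^ 'n) \<times> (real ^ 'n) \<Rightarrow> complex"
  assumes [measurable]: "g \<in> borel_measurable borel" and fg: "AE z in lborel. f z = g z"
  shows "AE z in lborel. truncated_weyl_kernel N f z = weyl_integral (x_truncate N g) z"
proof -
  have "AE z in lborel. AE x in lborel. f (x, snd z - fst z) = g (x, snd z - fst z)"
    using AE_lborel_difference[OF AE_lborel_pair(2)[OF fg]] .
  then show ?thesis
  proof eventually_elim
    case (elim z)
    let ?e = "\<lambda>x. cis (pi * (x \<bullet> (fst z + snd z)))"
    have gb: "(\<lambda>x. indicator (cball 0 (real N)) x *\<^sub>R (g (x, snd z - fst z) * ?e x)) \<in> borel_measurable borel"
      by (intro borel_measurable_scaleR borel_measurable_indicator borel_measurable_times) measurable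
    have "truncated_weyl_kernel N f z
        = (\<integral>x. indicator (cball 0 (real N)) x *\<^sub>R (f (x, snd z - fst z) * ?e x) \<partial>lebesgue)"
      by (simp add: truncated_weyl_kernel_def split_beta set_lebesgue_integral_def)
    also have "\<dots> = (\<integral>x. indicator (cball 0 (real N)) x *\<^sub>R (g (x, snd z - fst z) * ?e x) \<partial>lborel)"
      by (rule lebesgue_integral_borel_representative[OF gb]) (use elim in \<open>auto elim: eventually_mono\<close>)
    also have "\<dots> = weyl_integral (x_truncate N g) z"
      unfolding weyl_integral_def x_truncate_def
      by (intro Bochner_Integration.integral_cong) (auto simp: indicator_def)
    finally show ?case .
  qed
qed

lemma L2sq_finite_iff:
  assumes [measurable]: "f \<in> borel_measurable borel"
  shows "L2sq f < \<infinity> \<longleftrightarrow> integrable lborel (\<lambda>z. (cmod (f z))\<^sup>2)"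
  by (simp add: L2sq_def integrable_iff_bounded)

lemma in_L2_borel_representative:
  assumes "in_L2 f"
  obtains g where "g \<in> borel_measurable borel" "AE z in lborel. f z = g z" "L2sq g < \<infinity>"
proof -
  from assms have f: "f \<in> borel_measurable lebesgue" "integrable lebesgue (\<lambda>z. (cmod (f z))\<^sup>2)"
    by (auto simp: in_L2_def)
  obtain g where g: "g \<in> borel_measurable borel" "AE z in lborel. f z = g z"
    using lebesgue_measurable_borel_representative[OF f(1)] .
  have "L2sq g = L2sq f"
    using g(2) by (intro L2sq_cong_AE) (auto elim: eventually_mono)
  also have "\<dots> < \<infinity>"
    using f(2) by (simp add: L2sq_def integrable_iff_bounded nn_integral_completion)
  finally show thesis using g that by blast
qed

text \<open>
  By linearity and the Plancherel bound, the Weyl integrals of two truncations differ in norm by at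
  most the tail of \<open>f\<close>. So they form a Cauchy sequence.
\<close>

lemma weyl_integral_truncations_converge:
  fixes f :: "(real ^ 'n) \<times> (real ^ 'n) \<Rightarrow> complex"
  assumes [measurable]: "f \<in> borel_measurable borel" and fin: "L2sq f < \<infinity>"
  obtains K where "K \<in> borel_measurable borel" "L2sq K < \<infinity>"
    "(\<lambda>N. L2sq (\<lambda>z. weyl_integral (x_truncate N f) z - K z)) \<longlonglongrightarrow> 0"
proof -
  have trunc_fin: "L2sq (x_truncate N f) < \<infinity>" for N
    by (rule le_less_trans[OF _ fin]) (auto simp: L2sq_def x_truncate_def intro!: nn_integral_mono)
  have tail: "L2sq (\<lambda>z. weyl_integral (x_truncate m f) z - weyl_integral (x_truncate n f) z)
      \<le> L2sq (\<lambda>z. f z - x_truncate n f z)" if "n \<le> m" for m n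
  proof -
    \<comment> \<open>the difference of the two truncations, written as a finite sum over the booleans\<close>
    define c where "c b = (if b then 1 else - 1 :: complex)" for b
    define g where "g b = x_truncate (if b then m else n) f" for b
    have [measurable]: "g b \<in> borel_measurable borel" for b
      unfolding g_def by measurable
    have g_supp: "g b (x, y) = 0" if "real m < norm x" for b x y
      using that \<open>n \<le> m\<close> by (simp add: g_def x_truncate_def)
    have "AE z in lborel. weyl_integral (\<lambda>z. \<Sum>b\<in>UNIV. c b * g b z) z = (\<Sum>b\<in>UNIV. c b * weyl_integral (g b) z)"
      by (rule AE_weyl_integral_sum[where B = "real m"])
         (use g_supp trunc_fin in \<open>auto simp: g_def[abs_def]\<close>)
    then have "L2sq (\<lambda>z. weyl_integral (x_truncate m f) z - weyl_integral (x_truncate n f) z)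
        = L2sq (weyl_integral (\<lambda>z. \<Sum>b\<in>UNIV. c b * g b z))"
      by (intro L2sq_cong_AE, eventually_elim) (simp add: UNIV_bool c_def g_def)
    also have "\<dots> \<le> L2sq (\<lambda>z. \<Sum>b\<in>UNIV. c b * g b z)"
      by (rule weyl_integral_L2sq_le[where B = "real m"])
         (use g_supp in \<open>auto simp: UNIV_bool\<close>)
    also have "\<dots> \<le> L2sq (\<lambda>z. f z - x_truncate n f z)"
      unfolding L2sq_def
      by (rule nn_integral_mono) (use that in \<open>auto simp: UNIV_bool c_def g_def x_truncate_def\<close>)
    finally show ?thesis .
  qed
  obtain K where [measurable]: "K \<in> borel_measurable borel"
    and K: "(\<lambda>N. L2sq (\<lambda>z. weyl_integral (x_truncate N f) z - K z)) \<longlonglongrightarrow> 0"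
    by (rule L2_complete[OF _ tail L2sq_x_truncate_tail[OF assms(1) fin]]) auto
  have "\<forall>\<^sub>F N in sequentially. L2sq (\<lambda>z. weyl_integral (x_truncate N f) z - K z) < 1"
    using K by (rule order_tendstoD) simp
  then obtain N where N: "L2sq (\<lambda>z. weyl_integral (x_truncate N f) z - K z) < 1"
    using eventually_happens'[OF sequentially_bot] by blast
  have U: "L2sq (weyl_integral (x_truncate N f)) < \<infinity>"
    by (rule le_less_trans[OF weyl_integral_L2sq_le[where B = "real N"] trunc_fin[of N]])
       (auto simp: x_truncate_def)
  have "L2sq K = L2sq (\<lambda>z. - (weyl_integral (x_truncate N f) z - K z) + weyl_integral (x_truncate N f) z)"
    by simp
  also have "\<dots> \<le> 2 * L2sq (\<lambda>z. - (weyl_integral (x_truncate N f) z - K z)) + 2 * L2sq (weyl_integral (x_truncate N f))"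
    by (rule L2sq_add) measurable
  also have "L2sq (\<lambda>z. - (weyl_integral (x_truncate N f) z - K z)) = L2sq (\<lambda>z. weyl_integral (x_truncate N f) z - K z)"
    by (simp only: L2sq_def norm_minus_cancel)
  also have "2 * \<dots> + 2 * L2sq (weyl_integral (x_truncate N f)) < \<infinity>"
    using N U by (auto simp: ennreal_mult_eq_top_iff less_top[symmetric])
  finally have "L2sq K < \<infinity>" .
  with K show thesis by (intro that[of K]) auto
qed

text \<open>
  The function chosen by \<open>weyl_kernel\<close> is an \<open>L\<^sup>2\<close> limit only if such a limit exists, which
  \<open>weyl_integral_truncations_converge\<close> guarantees. Borel representatives make the slices measurable and
  leave Tonelli's theorem available.
\<close>

lemma weyl_kernel_borel_representatives:
  fixes \<phi> :: "(real ^ 'n) \<times> (real ^ 'n) \<Rightarrow> complex"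
  assumes \<phi>: "in_L2 \<phi>"
  obtains f K where "f \<in> borel_measurable borel" "AE z in lborel. \<phi> z = f z" "L2sq f < \<infinity>"
    "K \<in> borel_measurable borel" "AE z in lborel. weyl_kernel \<phi> z = K z" "L2sq K < \<infinity>"
    "(\<lambda>N. L2sq (\<lambda>z. weyl_integral (x_truncate N f) z - K z)) \<longlonglongrightarrow> 0"
proof -
  obtain f where f: "f \<in> borel_measurable borel" "AE z in lborel. \<phi> z = f z" "L2sq f < \<infinity>"
    using in_L2_borel_representative[OF \<phi>] .
  have trunc: "L2sq (\<lambda>z. truncated_weyl_kernel N \<phi> z - K z) = L2sq (\<lambda>z. weyl_integral (x_truncate N f) z - L z)"
    if "AE z in lborel. K z = L z" for N and K L :: "(real ^ 'n) \<times> (real ^ 'n) \<Rightarrow> complex"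
    using truncated_weyl_kernel_eq_weyl_integral[OF f(1,2), of N] that
    by (intro L2sq_cong_AE, eventually_elim) simp
  obtain K0 where K0: "K0 \<in> borel_measurable borel" "L2sq K0 < \<infinity>"
    "(\<lambda>N. L2sq (\<lambda>z. weyl_integral (x_truncate N f) z - K0 z)) \<longlonglongrightarrow> 0"
    using weyl_integral_truncations_converge[OF f(1,3)] .
  have "in_L2 K0"
    using K0(1) K0(2)[unfolded L2sq_finite_iff[OF K0(1)]]
    by (auto simp: in_L2_def integrable_completion intro!: measurable_completion)
  moreover have "L2_limit (\<lambda>N. truncated_weyl_kernel N \<phi>) K0"
    using K0(3) by (simp add: L2_limit_iff trunc[of K0 K0])
  ultimately have "\<exists>K. in_L2 K \<and> L2_limit (\<lambda>N. truncated_weyl_kernel N \<phi>) K"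
    by blast
  then have "in_L2 (weyl_kernel \<phi>) \<and> L2_limit (\<lambda>N. truncated_weyl_kernel N \<phi>) (weyl_kernel \<phi>)"
    unfolding weyl_kernel_def by (rule someI_ex)
  then have W: "in_L2 (weyl_kernel \<phi>)" "L2_limit (\<lambda>N. truncated_weyl_kernel N \<phi>) (weyl_kernel \<phi>)"
    by auto
  obtain K where K: "K \<in> borel_measurable borel" "AE z in lborel. weyl_kernel \<phi> z = K z" "L2sq K < \<infinity>"
    using in_L2_borel_representative[OF W(1)] .
  have "(\<lambda>N. L2sq (\<lambda>z. weyl_integral (x_truncate N f) z - K z)) \<longlonglongrightarrow> 0"
    using W(2) unfolding L2_limit_iff trunc[OF K(2)] .
  then show thesis by (rule that[OF f K(1,2,3)])
qed

text \<open>
  For the truncations of \<open>f\<close> the combination of kernels is the Weyl integral of the combination of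
  translates, to which the Plancherel bound applies; then the truncation is removed on both sides.
  The true constant is \<open>1\<close>. The factor \<open>4\<close> arises because \<open>|a + b|\<^sup>2 \<le> 2|a|\<^sup>2 + 2|b|\<^sup>2\<close> is used
  twice, in place of the triangle inequality, and it is harmless for sequences tending to \<open>0\<close>.
\<close>

lemma L2sq_kernel_combination_le:
  fixes f K :: "(real ^ 'n) \<times> (real ^ 'n) \<Rightarrow> complex"
  assumes [measurable]: "f \<in> borel_measurable borel" "K \<in> borel_measurable borel"
    and fin: "L2sq f < \<infinity>" and J: "finite J"
    and lim: "(\<lambda>N. L2sq (\<lambda>z. weyl_integral (x_truncate N f) z - K z)) \<longlonglongrightarrow> 0"
  shows "L2sq (\<lambda>z. \<Sum>j\<in>J. c j * kernel_translation j K z)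
    \<le> 4 * L2sq (\<lambda>z. \<Sum>j\<in>J. c j * twisted_translation j f z)"
proof -
  define C where "C = (\<Sum>j\<in>J. ennreal (card J * (cmod (c j))\<^sup>2))"
  define G where "G = L2sq (\<lambda>z. \<Sum>j\<in>J. c j * twisted_translation j f z)"
  define \<alpha> where "\<alpha> N = L2sq (\<lambda>z. weyl_integral (x_truncate N f) z - K z)" for N
  define \<beta> where "\<beta> N = L2sq (\<lambda>z. f z - x_truncate N f z)" for N
  have C: "C < top" by (simp add: C_def)
  have trunc_fin: "L2sq (x_truncate N f) < \<infinity>" for N
    by (rule le_less_trans[OF _ fin]) (auto simp: L2sq_def x_truncate_def intro!: nn_integral_mono)
  have step: "L2sq (\<lambda>z. \<Sum>j\<in>J. c j * kernel_translation j K z)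
      \<le> 2 * (C * \<alpha> N) + 2 * (2 * (C * \<beta> N) + 2 * G)" for N
  proof -
    define B where "B = real N + (\<Sum>j\<in>J. norm (int_vec (fst j)))"
    define g where "g = x_truncate N f"
    define h where "h z = (\<Sum>j\<in>J. c j * twisted_translation j g z)" for z
    have [measurable]: "g \<in> borel_measurable borel"
      unfolding g_def by measurable
    have [measurable]: "h \<in> borel_measurable borel"
      unfolding h_def by measurable
    have supp: "twisted_translation j g (x, y) = 0" if "j \<in> J" "B < norm x" for j x y
    proof -
      have "norm (int_vec (fst j)) \<le> (\<Sum>j\<in>J. norm (int_vec (fst j)))"
        using J that(1) by (intro member_le_sum) auto
      then have "real N < norm (x - int_vec (fst j))"
        using that(2) norm_triangle_ineq2[of x "int_vec (fst j)"] by (simp add: B_def)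
      then show ?thesis by (simp add: twisted_translation_eq g_def x_truncate_def)
    qed
    have "AE z in lborel. weyl_integral h z = (\<Sum>j\<in>J. c j * weyl_integral (twisted_translation j g) z)"
      unfolding h_def
      by (rule AE_weyl_integral_sum[where B = B, OF J])
         (use trunc_fin supp in \<open>auto simp: L2sq_twisted_translation g_def\<close>)
    then have U: "L2sq (\<lambda>z. \<Sum>j\<in>J. c j * kernel_translation j (weyl_integral g) z) = L2sq (weyl_integral h)"
      by (intro L2sq_cong_AE, eventually_elim) (simp add: weyl_integral_twisted_translation)
    have "L2sq (weyl_integral h) \<le> L2sq h"
      by (rule weyl_integral_L2sq_le[where B = B]) (auto simp: h_def supp)
    also have "\<dots> = L2sq (\<lambda>z. (\<Sum>j\<in>J. - c j * twisted_translation j (\<lambda>z. f z - g z) z)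
        + (\<Sum>j\<in>J. c j * twisted_translation j f z))"
      unfolding sum.distrib[symmetric] h_def
      by (simp add: twisted_translation_eq algebra_simps)
    also have "\<dots> \<le> 2 * L2sq (\<lambda>z. \<Sum>j\<in>J. - c j * twisted_translation j (\<lambda>z. f z - g z) z) + 2 * G"
      unfolding G_def by (rule L2sq_add) measurable
    also have "L2sq (\<lambda>z. \<Sum>j\<in>J. - c j * twisted_translation j (\<lambda>z. f z - g z) z)
        \<le> (\<Sum>j\<in>J. ennreal (card J * (cmod (- c j))\<^sup>2) * L2sq (twisted_translation j (\<lambda>z. f z - g z)))"
      by (rule L2sq_sum) measurable
    also have "\<dots> = C * \<beta> N"
      by (simp add: C_def \<beta>_def g_def L2sq_twisted_translation sum_distrib_right del: sum_ennreal)
    finally have Uh: "L2sq (weyl_integral h) \<le> 2 * (C * \<beta> N) + 2 * G"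
      by (simp add: mult_left_mono add_mono)
    have "L2sq (\<lambda>z. \<Sum>j\<in>J. c j * kernel_translation j K z)
        = L2sq (\<lambda>z. (\<Sum>j\<in>J. - c j * kernel_translation j (\<lambda>z. weyl_integral g z - K z) z)
        + (\<Sum>j\<in>J. c j * kernel_translation j (weyl_integral g) z))"
      unfolding sum.distrib[symmetric] by (simp add: kernel_translation_def algebra_simps)
    also have "\<dots> \<le> 2 * L2sq (\<lambda>z. \<Sum>j\<in>J. - c j * kernel_translation j (\<lambda>z. weyl_integral g z - K z) z)
        + 2 * L2sq (\<lambda>z. \<Sum>j\<in>J. c j * kernel_translation j (weyl_integral g) z)"
      by (rule L2sq_add) measurable
    also have "L2sq (\<lambda>z. \<Sum>j\<in>J. - c j * kernel_translation j (\<lambda>z. weyl_integral g z - K z) z)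
        \<le> (\<Sum>j\<in>J. ennreal (card J * (cmod (- c j))\<^sup>2) * L2sq (kernel_translation j (\<lambda>z. weyl_integral g z - K z)))"
      by (rule L2sq_sum) measurable
    also have "\<dots> = C * \<alpha> N"
      by (simp add: C_def \<alpha>_def g_def L2sq_kernel_translation sum_distrib_right del: sum_ennreal)
    finally have "L2sq (\<lambda>z. \<Sum>j\<in>J. c j * kernel_translation j K z)
        \<le> 2 * (C * \<alpha> N) + 2 * L2sq (weyl_integral h)"
      unfolding U by (simp add: mult_left_mono add_mono)
    also have "\<dots> \<le> 2 * (C * \<alpha> N) + 2 * (2 * (C * \<beta> N) + 2 * G)"
      using Uh by (intro add_left_mono mult_left_mono) auto
    finally show ?thesis .
  qed
  have "(\<lambda>N. 2 * (C * \<alpha> N) + 2 * (2 * (C * \<beta> N) + 2 * G)) \<longlonglongrightarrow> 2 * (C * 0) + 2 * (2 * (C * 0) + 2 * G)"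
    using lim L2sq_x_truncate_tail[OF assms(1) fin] C
    unfolding \<alpha>_def \<beta>_def by (intro tendsto_add tendsto_const ennreal_tendsto_cmult) auto
  then have "L2sq (\<lambda>z. \<Sum>j\<in>J. c j * kernel_translation j K z) \<le> 2 * (C * 0) + 2 * (2 * (C * 0) + 2 * G)"
    by (rule LIMSEQ_le_const) (use step in blast)
  then show ?thesis by (simp add: G_def mult.assoc[symmetric])
qed

section \<open>Orthogonality of the translates of the kernel\<close>

lemma has_sum_finite_sum:
  fixes f :: "'i \<Rightarrow> 'a \<Rightarrow> 'b::topological_comm_monoid_add"
  assumes "finite I" "\<And>i. i \<in> I \<Longrightarrow> (f i has_sum s i) A"
  shows "((\<lambda>x. \<Sum>i\<in>I. f i x) has_sum (\<Sum>i\<in>I. s i)) A"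
  using assms by (induction I rule: finite_induct) (auto intro: has_sum_add)

text \<open>
  Pythagoras in the Hilbert sum of copies of \<open>L\<^sup>2(M)\<close>: the vectors \<open>m \<mapsto> v (m + l)\<close> all have the
  squared norm \<open>w\<close> and are pairwise orthogonal.
\<close>

lemma has_sum_norm_square_orthogonal_translates:
  fixes v :: "'i::ab_group_add \<Rightarrow> 'b \<Rightarrow> complex"
  assumes v: "\<And>m. v m \<in> borel_measurable M" "\<And>m. integrable M (\<lambda>x. (cmod (v m x))\<^sup>2)"
    and norm: "((\<lambda>m. \<integral>x. (cmod (v m x))\<^sup>2 \<partial>M) has_sum w) UNIV"
    and orth: "\<And>l. l \<noteq> 0 \<Longrightarrow> ((\<lambda>m. \<integral>x. v m x * cnj (v (m + l) x) \<partial>M) has_sum 0) UNIV"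
    and L: "finite L"
  shows "((\<lambda>m. \<integral>x. (cmod (\<Sum>l\<in>L. a l * v (m + l) x))\<^sup>2 \<partial>M) has_sum (\<Sum>l\<in>L. (cmod (a l))\<^sup>2) * w) UNIV"
proof -
  define ip where "ip m k = (\<integral>x. v m x * cnj (v k x) \<partial>M)" for m k
  have [measurable]: "v m \<in> borel_measurable M" for m by (rule v)
  have int: "integrable M (\<lambda>x. v m x * cnj (v k x))" for m k
  proof (rule Bochner_Integration.integrable_bound[OF Bochner_Integration.integrable_add[OF v(2)[of m] v(2)[of k]]])
    have "cmod (v m x * cnj (v k x)) \<le> (cmod (v m x))\<^sup>2 + (cmod (v k x))\<^sup>2" for x
      using sum_squares_bound[of "cmod (v m x)" "cmod (v k x)"]
        mult_nonneg_nonneg[OF norm_ge_zero[of "v m x"] norm_ge_zero[of "v k x"]]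
      unfolding norm_mult complex_mod_cnj by linarith
    then show "AE x in M. norm (v m x * cnj (v k x)) \<le> norm ((cmod (v m x))\<^sup>2 + (cmod (v k x))\<^sup>2)"
      by (auto intro: order_trans)
  qed measurable
  have expand: "complex_of_real (\<integral>x. (cmod (\<Sum>l\<in>L. a l * v (m + l) x))\<^sup>2 \<partial>M)
      = (\<Sum>l\<in>L. \<Sum>k\<in>L. a l * cnj (a k) * ip (m + l) (m + k))" for m
  proof -
    have "complex_of_real (\<integral>x. (cmod (\<Sum>l\<in>L. a l * v (m + l) x))\<^sup>2 \<partial>M)
        = (\<integral>x. (\<Sum>l\<in>L. a l * v (m + l) x) * cnj (\<Sum>l\<in>L. a l * v (m + l) x) \<partial>M)"
      by (simp only: integral_complex_of_real[symmetric] complex_norm_square)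
    also have "\<dots> = (\<integral>x. (\<Sum>l\<in>L. \<Sum>k\<in>L. a l * cnj (a k) * (v (m + l) x * cnj (v (m + k) x))) \<partial>M)"
      by (simp add: sum_product mult_ac)
    also have "\<dots> = (\<Sum>l\<in>L. \<Sum>k\<in>L. a l * cnj (a k) * ip (m + l) (m + k))"
      unfolding ip_def using int by simp
    finally show ?thesis .
  qed
  have ip_sum: "((\<lambda>m. ip (m + l) (m + k)) has_sum (if l = k then complex_of_real w else 0)) UNIV" for l k
  proof -
    have "((\<lambda>m. ip m (m + (k - l))) has_sum (if l = k then complex_of_real w else 0)) UNIV"
    proof (cases "l = k")
      case True
      have "ip m m = complex_of_real (\<integral>x. (cmod (v m x))\<^sup>2 \<partial>M)" for m
        unfolding ip_def by (simp only: integral_complex_of_real[symmetric] complex_norm_square)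
      then show ?thesis
        using has_sum_bounded_linear[OF bounded_linear_of_real norm, where 'a1 = complex] True by simp
    next
      case False
      then show ?thesis using orth[of "k - l"] by (simp add: ip_def)
    qed
    then have "((\<lambda>m. ip (m + l) ((m + l) + (k - l))) has_sum (if l = k then complex_of_real w else 0)) UNIV"
      by (subst has_sum_reindex_bij_witness[where i = "\<lambda>m. m + l" and j = "\<lambda>m. m - l"
            and T = UNIV and h = "\<lambda>m. ip (m + l) ((m + l) + (k - l))"
            and g = "\<lambda>m. ip m (m + (k - l))" and S = UNIV, symmetric]) auto
    then show ?thesis by (simp add: add.assoc)
  qed
  have "((\<lambda>m. \<Sum>l\<in>L. \<Sum>k\<in>L. a l * cnj (a k) * ip (m + l) (m + k))
      has_sum (\<Sum>l\<in>L. \<Sum>k\<in>L. a l * cnj (a k) * (if l = k then complex_of_real w else 0))) UNIV"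
    by (intro has_sum_finite_sum has_sum_cmult_right L ip_sum)
  also have "(\<Sum>l\<in>L. \<Sum>k\<in>L. a l * cnj (a k) * (if l = k then complex_of_real w else 0))
      = complex_of_real ((\<Sum>l\<in>L. (cmod (a l))\<^sup>2) * w)"
    using L by (simp add: sum_distrib_right complex_norm_square if_distrib sum.delta' cong: if_cong del: of_real_power)
  finally have "((\<lambda>m. complex_of_real (\<integral>x. (cmod (\<Sum>l\<in>L. a l * v (m + l) x))\<^sup>2 \<partial>M))
      has_sum complex_of_real ((\<Sum>l\<in>L. (cmod (a l))\<^sup>2) * w)) UNIV"
    unfolding expand .
  from has_sum_Re[OF this] show ?thesis by (simp only: Re_complex_of_real)
qed

lemma summable_on_of_nn_integral_count_space:
  fixes f :: "'a \<Rightarrow> real"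
  assumes fin: "(\<integral>\<^sup>+x. ennreal (f x) \<partial>count_space UNIV) < \<infinity>" and "\<And>x. 0 \<le> f x"
  shows "f summable_on UNIV"
proof -
  have "integrable (count_space UNIV) f"
    using assms by (intro integrableI_nonneg) auto
  then have "Infinite_Set_Sum.abs_summable_on f UNIV"
    by (simp add: Infinite_Set_Sum.abs_summable_on_def)
  then have "(\<lambda>x. norm (f x)) summable_on UNIV"
    using abs_summable_equivalent by blast
  then show ?thesis using assms(2) by simp
qed

text \<open>
  The form of Pythagoras that is integrated over the torus: only the term of one index \<open>l0\<close> is
  kept.
\<close>

lemma weighted_coefficient_le:
  fixes v :: "'i::ab_group_add \<Rightarrow> 'b \<Rightarrow> complex"
  assumes v [measurable]: "\<And>m. v m \<in> borel_measurable M"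
    and fin: "(\<integral>\<^sup>+m. (\<integral>\<^sup>+x. ennreal ((cmod (v m x))\<^sup>2) \<partial>M) \<partial>count_space UNIV) < \<infinity>"
    and orth: "\<And>l. l \<noteq> 0 \<Longrightarrow> ((\<lambda>m. \<integral>x. v m x * cnj (v (m + l) x) \<partial>M) has_sum 0) UNIV"
    and L: "finite L" "l0 \<in> L"
  shows "ennreal ((cmod (a l0))\<^sup>2) * (\<integral>\<^sup>+m. (\<integral>\<^sup>+x. ennreal ((cmod (v m x))\<^sup>2) \<partial>M) \<partial>count_space UNIV)
    \<le> (\<integral>\<^sup>+m. (\<integral>\<^sup>+x. ennreal ((cmod (\<Sum>l\<in>L. a l * v (m + l) x))\<^sup>2) \<partial>M) \<partial>count_space UNIV)"
proof -
  have fin1: "(\<integral>\<^sup>+x. ennreal ((cmod (v m x))\<^sup>2) \<partial>M) < \<infinity>" for m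
    by (rule le_less_trans[OF nn_integral_ge_point fin]) simp
  have int: "integrable M (\<lambda>x. (cmod (v m x))\<^sup>2)" for m
    using fin1[of m] by (intro integrableI_nonneg) auto
  define n where "n m = (\<integral>x. (cmod (v m x))\<^sup>2 \<partial>M)" for m
  have n: "(\<integral>\<^sup>+x. ennreal ((cmod (v m x))\<^sup>2) \<partial>M) = ennreal (n m)" "0 \<le> n m" for m
    unfolding n_def by (auto intro!: nn_integral_eq_integral int integral_nonneg_AE)
  define w where "w = infsum n UNIV"
  have w: "(n has_sum w) UNIV"
    unfolding w_def using fin n by (intro has_sum_infsum summable_on_of_nn_integral_count_space) auto
  have W: "(\<integral>\<^sup>+m. (\<integral>\<^sup>+x. ennreal ((cmod (v m x))\<^sup>2) \<partial>M) \<partial>count_space UNIV) = ennreal w"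
    unfolding n by (rule nn_integral_count_space_has_sum[OF w n(2)])
  have w0: "0 \<le> w" unfolding w_def by (intro infsum_nonneg n)
  have pyth: "(\<integral>\<^sup>+m. ennreal (\<integral>x. (cmod (\<Sum>l\<in>L. a l * v (m + l) x))\<^sup>2 \<partial>M) \<partial>count_space UNIV)
      = ennreal ((\<Sum>l\<in>L. (cmod (a l))\<^sup>2) * w)"
    using w unfolding n_def
    by (intro nn_integral_count_space_has_sum has_sum_norm_square_orthogonal_translates v int orth L)
       (auto intro!: integral_nonneg_AE)
  have "ennreal (\<integral>x. (cmod (\<Sum>l\<in>L. a l * v (m + l) x))\<^sup>2 \<partial>M)
      \<le> (\<integral>\<^sup>+x. ennreal ((cmod (\<Sum>l\<in>L. a l * v (m + l) x))\<^sup>2) \<partial>M)" for m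
  proof -
    have "ennreal (\<integral>x. (cmod (\<Sum>l\<in>L. a l * v (m + l) x))\<^sup>2 \<partial>M)
        = ennreal (enn2real (\<integral>\<^sup>+x. ennreal ((cmod (\<Sum>l\<in>L. a l * v (m + l) x))\<^sup>2) \<partial>M))"
      by (subst integral_eq_nn_integral) auto
    then show ?thesis
      by (simp add: ennreal_enn2real_if)
  qed
  then have le: "(\<integral>\<^sup>+m. ennreal (\<integral>x. (cmod (\<Sum>l\<in>L. a l * v (m + l) x))\<^sup>2 \<partial>M) \<partial>count_space UNIV)
      \<le> (\<integral>\<^sup>+m. (\<integral>\<^sup>+x. ennreal ((cmod (\<Sum>l\<in>L. a l * v (m + l) x))\<^sup>2) \<partial>M) \<partial>count_space UNIV)"
    by (intro nn_integral_mono)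
  have "ennreal ((cmod (a l0))\<^sup>2) * ennreal w = ennreal ((cmod (a l0))\<^sup>2 * w)"
    using w0 by (simp add: ennreal_mult)
  also have "\<dots> \<le> ennreal ((\<Sum>l\<in>L. (cmod (a l))\<^sup>2) * w)"
    using L w0 by (intro ennreal_leI mult_right_mono member_le_sum) auto
  also note pyth[symmetric]
  also note le
  finally show ?thesis
    unfolding W .
qed

section \<open>Vanishing of the coefficients\<close>

text \<open>
  The coefficient is at most \<open>\<integral> |A|\<close>, where \<open>A\<close> is the polynomial. Put \<open>t = |A|\<close>. Where \<open>W < \<epsilon>\<close>,
  \<open>t \<le> \<delta>t\<^sup>2 + 1/\<delta>\<close>; elsewhere \<open>t \<le> \<delta> + t\<^sup>2/\<delta> \<le> \<delta> + t\<^sup>2 W/(\<delta>\<epsilon>)\<close>. Integrate, and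
  use Parseval's identity to bound \<open>\<integral> t\<^sup>2\<close> by \<open>C\<close>.
\<close>

lemma coefficient_le_weighted_norm:
  fixes W :: "real ^ 'n \<Rightarrow> ennreal" and d :: "int ^ 'n \<Rightarrow> complex"
  assumes [measurable]: "W \<in> borel_measurable borel"
    and S: "finite S" "k0 \<in> S" and bound: "(\<Sum>k\<in>S. (cmod (d k))\<^sup>2) \<le> C"
    and pos: "0 < \<delta>" "0 < \<epsilon>"
  shows "ennreal (cmod (d k0)) \<le> ennreal (\<delta> * C + \<delta>)
    + ennreal (1 / \<delta>) * (\<integral>\<^sup>+\<xi>. (if W \<xi> < ennreal \<epsilon> then 1 else 0) \<partial>cell_measure 0 1)
    + ennreal (1 / (\<delta> * \<epsilon>)) *
      (\<integral>\<^sup>+\<xi>. ennreal ((cmod (\<Sum>k\<in>S. d k * lattice_char 1 k \<xi>))\<^sup>2) * W \<xi> \<partial>cell_measure 0 1)"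
proof -
  define A where "A \<xi> = (\<Sum>k\<in>S. d k * lattice_char 1 k \<xi>)" for \<xi>
  define \<mu> where "\<mu> = (cell_measure 0 1 :: (real ^ 'n) measure)"
  have [measurable]: "A \<in> borel_measurable borel" unfolding A_def by measurable
  have [measurable]: "A \<in> borel_measurable \<mu>" "W \<in> borel_measurable \<mu>" unfolding \<mu>_def by measurable
  interpret finite_measure \<mu> unfolding \<mu>_def by (rule finite_cell_measure) simp
  have int: "integrable \<mu> A" "integrable \<mu> (\<lambda>\<xi>. (cmod (A \<xi>))\<^sup>2)"
    unfolding \<mu>_def A_def using trig_poly_bound[of d 1 _ S]
    by (intro integrable_cell_bounded[where B = "\<Sum>k\<in>S. cmod (d k)"]
        integrable_cell_bounded[where B = "(\<Sum>k\<in>S. cmod (d k))\<^sup>2"]; auto intro!: power_mono)+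
  have pointwise: "ennreal (cmod (A \<xi>)) \<le> ennreal (\<delta> * (cmod (A \<xi>))\<^sup>2 + \<delta>)
      + ennreal (1 / \<delta>) * (if W \<xi> < ennreal \<epsilon> then 1 else 0)
      + ennreal (1 / (\<delta> * \<epsilon>)) * (ennreal ((cmod (A \<xi>))\<^sup>2) * W \<xi>)" for \<xi>
  proof -
    define t where "t = cmod (A \<xi>)"
    have t0: "0 \<le> t" by (simp add: t_def)
    show ?thesis
    proof (cases "W \<xi> < ennreal \<epsilon>")
      case True
      have "t * \<delta> \<le> (t * \<delta>)\<^sup>2 + 1"
        using zero_le_power2[of "t * \<delta> - 1"] t0 pos mult_nonneg_nonneg[of t \<delta>]
        unfolding power2_diff one_power2 mult_1_right by linarith
      then have "t \<le> \<delta> * t\<^sup>2 + 1 / \<delta>"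
        using pos by (simp add: field_simps power2_eq_square)
      then have "t \<le> (\<delta> * t\<^sup>2 + \<delta>) + 1 / \<delta>"
        using pos by simp
      then have "ennreal t \<le> ennreal (\<delta> * t\<^sup>2 + \<delta>) + ennreal (1 / \<delta>)"
        using pos by (simp add: ennreal_plus[symmetric] del: ennreal_plus)
      also have "\<dots> \<le> ennreal (\<delta> * t\<^sup>2 + \<delta>) + ennreal (1 / \<delta>) + ennreal (1 / (\<delta> * \<epsilon>)) * (ennreal (t\<^sup>2) * W \<xi>)"
        by simp
      finally show ?thesis using True by (simp add: t_def)
    next
      case False
      have "t * \<delta> \<le> \<delta>\<^sup>2 + t\<^sup>2"
        using zero_le_power2[of "t - \<delta>"] mult_nonneg_nonneg[of t \<delta>] t0 pos
        unfolding power2_diff by linarith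
      then have "t \<le> \<delta> + t\<^sup>2 / \<delta>"
        using pos by (simp add: field_simps power2_eq_square)
      also have "\<dots> \<le> (\<delta> * t\<^sup>2 + \<delta>) + (1 / (\<delta> * \<epsilon>)) * (t\<^sup>2 * \<epsilon>)"
        using pos by simp
      finally have "ennreal t \<le> ennreal ((\<delta> * t\<^sup>2 + \<delta>) + (1 / (\<delta> * \<epsilon>)) * (t\<^sup>2 * \<epsilon>))"
        by (rule ennreal_leI)
      also have "\<dots> = ennreal (\<delta> * t\<^sup>2 + \<delta>) + ennreal (1 / (\<delta> * \<epsilon>)) * (ennreal (t\<^sup>2) * ennreal \<epsilon>)"
        using pos by (simp add: ennreal_mult'[symmetric] ennreal_mult[symmetric] ennreal_plus[symmetric] del: ennreal_plus)
      also have "\<dots> \<le> ennreal (\<delta> * t\<^sup>2 + \<delta>) + ennreal (1 / (\<delta> * \<epsilon>)) * (ennreal (t\<^sup>2) * W \<xi>)"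
        using False by (intro add_left_mono mult_left_mono) auto
      finally show ?thesis using False by (simp add: t_def)
    qed
  qed
  have "cmod (d k0) = cmod (\<integral>\<xi>. A \<xi> * cnj (lattice_char 1 k0 \<xi>) \<partial>\<mu>)"
    unfolding A_def \<mu>_def using trig_poly_coefficient[where r = 1 and S = S and c = d and m = k0 and a = 0] S by simp
  also have "ennreal \<dots> \<le> (\<integral>\<^sup>+\<xi>. ennreal (cmod (A \<xi>)) \<partial>\<mu>)"
    using integral_norm_bound_ennreal[of \<mu> "\<lambda>\<xi>. A \<xi> * cnj (lattice_char 1 k0 \<xi>)"] int(1)
    by (cases "integrable \<mu> (\<lambda>\<xi>. A \<xi> * cnj (lattice_char 1 k0 \<xi>))")
       (auto simp: norm_mult not_integrable_integral_eq)
  also have "\<dots> \<le> (\<integral>\<^sup>+\<xi>. ennreal (\<delta> * (cmod (A \<xi>))\<^sup>2 + \<delta>)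
      + ennreal (1 / \<delta>) * (if W \<xi> < ennreal \<epsilon> then 1 else 0)
      + ennreal (1 / (\<delta> * \<epsilon>)) * (ennreal ((cmod (A \<xi>))\<^sup>2) * W \<xi>) \<partial>\<mu>)"
    by (rule nn_integral_mono) (rule pointwise)
  also have "\<dots> = (\<integral>\<^sup>+\<xi>. ennreal (\<delta> * (cmod (A \<xi>))\<^sup>2 + \<delta>) \<partial>\<mu>)
      + ennreal (1 / \<delta>) * (\<integral>\<^sup>+\<xi>. (if W \<xi> < ennreal \<epsilon> then 1 else 0) \<partial>\<mu>)
      + ennreal (1 / (\<delta> * \<epsilon>)) * (\<integral>\<^sup>+\<xi>. ennreal ((cmod (A \<xi>))\<^sup>2) * W \<xi> \<partial>\<mu>)"
    by (simp add: nn_integral_add nn_integral_cmult)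
  also have "(\<integral>\<^sup>+\<xi>. ennreal (\<delta> * (cmod (A \<xi>))\<^sup>2 + \<delta>) \<partial>\<mu>) = ennreal (\<integral>\<xi>. \<delta> * (cmod (A \<xi>))\<^sup>2 + \<delta> \<partial>\<mu>)"
    using int pos by (intro nn_integral_eq_integral) auto
  also have "(\<integral>\<xi>. \<delta> * (cmod (A \<xi>))\<^sup>2 + \<delta> \<partial>\<mu>) = \<delta> * (\<Sum>k\<in>S. (cmod (d k))\<^sup>2) + \<delta>"
    using int trig_poly_parseval[where r = 1 and S = S and c = d and a = 0] S
    by (simp add: A_def[symmetric] \<mu>_def[symmetric])
       (simp add: \<mu>_def measure_restrict_space measure_cell)
  also have "ennreal \<dots> \<le> ennreal (\<delta> * C + \<delta>)"
    using bound pos by (intro ennreal_leI) simp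
  finally show ?thesis
    by (simp add: A_def \<mu>_def add_mono)
qed

text \<open>
  In \<open>coefficient_le_weighted_norm\<close> let first \<open>N \<rightarrow> \<infinity>\<close>, then \<open>\<epsilon> \<rightarrow> 0\<close>, and finally
  \<open>\<delta> \<rightarrow> 0\<close>. The second limit uses that \<open>W\<close> is positive almost everywhere.
\<close>

lemma coefficient_vanishes:
  fixes W :: "real ^ 'n \<Rightarrow> ennreal" and d :: "int ^ 'n \<Rightarrow> complex" and S :: "nat \<Rightarrow> (int ^ 'n) set"
  assumes [measurable]: "W \<in> borel_measurable borel"
    and pos: "AE \<xi> in cell_measure 0 1. 0 < W \<xi>"
    and S: "\<And>N. finite (S N)" "\<forall>\<^sub>F N in sequentially. k0 \<in> S N"
    and bound: "\<And>N. (\<Sum>k\<in>S N. (cmod (d k))\<^sup>2) \<le> C"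
    and lim: "(\<lambda>N. \<integral>\<^sup>+\<xi>. ennreal ((cmod (\<Sum>k\<in>S N. d k * lattice_char 1 k \<xi>))\<^sup>2) * W \<xi> \<partial>cell_measure 0 1) \<longlonglongrightarrow> 0"
  shows "d k0 = 0"
proof -
  define E where "E \<epsilon> = (\<integral>\<^sup>+\<xi>. (if W \<xi> < ennreal \<epsilon> then 1 else 0) \<partial>(cell_measure 0 1 :: (real ^ 'n) measure))" for \<epsilon>
  have step1: "ennreal (cmod (d k0)) \<le> ennreal (\<delta> * C + \<delta>) + ennreal (1 / \<delta>) * E \<epsilon>"
    if "0 < \<delta>" "0 < \<epsilon>" for \<delta> \<epsilon>
  proof -
    have "(\<lambda>N. ennreal (\<delta> * C + \<delta>) + ennreal (1 / \<delta>) * E \<epsilon> + ennreal (1 / (\<delta> * \<epsilon>)) *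
      (\<integral>\<^sup>+\<xi>. ennreal ((cmod (\<Sum>k\<in>S N. d k * lattice_char 1 k \<xi>))\<^sup>2) * W \<xi> \<partial>cell_measure 0 1))
      \<longlonglongrightarrow> ennreal (\<delta> * C + \<delta>) + ennreal (1 / \<delta>) * E \<epsilon> + ennreal (1 / (\<delta> * \<epsilon>)) * 0"
      using lim by (intro tendsto_add tendsto_const ennreal_tendsto_cmult) auto
    moreover have "\<forall>\<^sub>F N in sequentially. ennreal (cmod (d k0)) \<le> ennreal (\<delta> * C + \<delta>) + ennreal (1 / \<delta>) * E \<epsilon>
      + ennreal (1 / (\<delta> * \<epsilon>)) *
      (\<integral>\<^sup>+\<xi>. ennreal ((cmod (\<Sum>k\<in>S N. d k * lattice_char 1 k \<xi>))\<^sup>2) * W \<xi> \<partial>cell_measure 0 1)"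
      using S(2) unfolding E_def
      by eventually_elim (rule coefficient_le_weighted_norm[OF assms(1) S(1) _ bound that])
    ultimately have "ennreal (cmod (d k0)) \<le> ennreal (\<delta> * C + \<delta>) + ennreal (1 / \<delta>) * E \<epsilon> + ennreal (1 / (\<delta> * \<epsilon>)) * 0"
      by (rule tendsto_lowerbound) simp
    then show ?thesis by simp
  qed
  have E_lim: "(\<lambda>n. E (1 / real (Suc n))) \<longlonglongrightarrow> 0"
  proof -
    have "(\<lambda>n. E (1 / real (Suc n))) \<longlonglongrightarrow> (\<integral>\<^sup>+\<xi>. 0 \<partial>(cell_measure 0 1 :: (real ^ 'n) measure))"
      unfolding E_def
    proof (rule nn_integral_dominated_convergence[where w = "\<lambda>_. 1"])
      show "AE \<xi> in cell_measure 0 1. (\<lambda>n. if W \<xi> < ennreal (1 / real (Suc n)) then 1 else 0) \<longlonglongrightarrow> (0 :: ennreal)"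
        using pos
      proof eventually_elim
        case (elim \<xi>)
        have "(\<lambda>n. ennreal (1 / real (Suc n))) \<longlonglongrightarrow> ennreal 0"
          by (intro tendsto_ennrealI LIMSEQ_Suc lim_1_over_n)
        then have "\<forall>\<^sub>F n in sequentially. ennreal (1 / real (Suc n)) < W \<xi>"
          using elim by (intro order_tendstoD) auto
        then have "\<forall>\<^sub>F n in sequentially. (if W \<xi> < ennreal (1 / real (Suc n)) then 1 else 0) = (0 :: ennreal)"
          by eventually_elim auto
        then show ?case by (rule tendsto_eventually)
      qed
      show "(\<integral>\<^sup>+\<xi>. 1 \<partial>(cell_measure 0 1 :: (real ^ 'n) measure)) < \<infinity>"
        by (simp add: emeasure_restrict_space emeasure_cell)
    qed auto
    then show ?thesis by simp
  qed
  have step2: "ennreal (cmod (d k0)) \<le> ennreal (\<delta> * C + \<delta>)" if "0 < \<delta>" for \<delta>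
  proof -
    have "(\<lambda>n. ennreal (\<delta> * C + \<delta>) + ennreal (1 / \<delta>) * E (1 / real (Suc n)))
      \<longlonglongrightarrow> ennreal (\<delta> * C + \<delta>) + ennreal (1 / \<delta>) * 0"
      using E_lim by (intro tendsto_add tendsto_const ennreal_tendsto_cmult) auto
    then have "ennreal (cmod (d k0)) \<le> ennreal (\<delta> * C + \<delta>) + ennreal (1 / \<delta>) * 0"
      by (rule LIMSEQ_le_const) (use step1[OF that] in auto)
    then show ?thesis by simp
  qed
  have C: "0 \<le> C"
    using bound[of 0] by (rule order_trans[rotated]) (simp add: sum_nonneg)
  have "cmod (d k0) \<le> 0"
  proof (rule field_le_epsilon)
    fix e :: real assume "0 < e"
    then have "cmod (d k0) \<le> e / (C + 1) * C + e / (C + 1)"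
      using C by (intro iffD1[OF ennreal_le_iff step2]) auto
    also have "\<dots> = e / (C + 1) * (C + 1)"
      by (simp only: distrib_left mult_1_right)
    also have "\<dots> = e"
      using C by simp
    finally show "cmod (d k0) \<le> 0 + e" by simp
  qed
  then show ?thesis by simp
qed

section \<open>Independence of the twisted translates\<close>

definition index_box :: "nat \<Rightarrow> (int ^ 'n) set" where
  "index_box N = {k. \<forall>i. \<bar>k $ i\<bar> \<le> int N}"

lemma finite_index_box: "finite (index_box N :: (int ^ 'n) set)"
proof (rule finite_imageD)
  have "vec_nth ` index_box N \<subseteq> PiE UNIV (\<lambda>_ :: 'n. {- int N..int N})"
    by (auto simp: index_box_def abs_le_iff minus_le_iff)
  then show "finite (vec_nth ` (index_box N :: (int ^ 'n) set))"
    by (rule finite_subset) (auto intro: finite_PiE)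
qed (auto simp: inj_on_def vec_nth_inject)

lemma index_cube_eq: "index_cube N = index_box N \<times> index_box N"
  by (auto simp: index_cube_def index_box_def)

lemma eventually_in_index_box: "\<forall>\<^sub>F N in sequentially. (k :: int ^ 'n) \<in> index_box N"
proof -
  define M where "M = nat (\<Sum>i\<in>UNIV. \<bar>k $ i\<bar>)"
  have "\<bar>k $ i\<bar> \<le> (\<Sum>i\<in>UNIV. \<bar>k $ i\<bar>)" for i
    by (rule member_le_sum) auto
  then have "\<bar>k $ i\<bar> \<le> int M" for i
    by (simp add: M_def sum_nonneg)
  then have "k \<in> index_box N" if "M \<le> N" for N
    unfolding index_box_def using order_trans[OF _ of_nat_mono[OF that]] by blast
  then show ?thesis
    using eventually_ge_at_top[of M] by (rule eventually_mono[rotated])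
qed

lemma AE_torus_iff:
  "(AE \<xi> in lebesgue_on torus. P \<xi>) \<longleftrightarrow> (AE \<xi> in lborel. \<xi> \<in> cell 0 1 \<longrightarrow> P (\<xi> :: real ^ 'n))"
  unfolding torus_eq_cell by (subst AE_restrict_space_iff) (auto simp: AE_completion_iff)

text \<open>
  The weight and condition C evaluate the kernel on countably many slices; for almost every \<open>\<xi>\<close>
  none of these slices sees a change of the kernel on a null set.
\<close>

lemma AE_lattice_slices:
  fixes F K :: "(real ^ 'n) \<times> 'b::euclidean_space \<Rightarrow> complex"
  assumes "AE z in lborel. F z = K z"
  shows "AE \<xi> in lborel. \<forall>m. AE \<eta> in lborel. F (\<xi> + int_vec m, \<eta>) = K (\<xi> + int_vec m, \<eta>)"
  unfolding AE_all_countable using AE_lborel_translate[OF AE_lborel_pair(1)[OF assms]] by blast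

text \<open>
  The characters are periodic, so the coefficient polynomials do not depend on \<open>m\<close>.
\<close>

lemma kernel_combination_slice:
  fixes c :: "(int ^ 'n) \<times> (int ^ 'n) \<Rightarrow> complex"
  shows "(\<Sum>j\<in>index_cube N. c j * kernel_translation j K (\<xi> + int_vec m, \<eta>))
    = (\<Sum>l\<in>index_box N. (\<Sum>k\<in>index_box N. c (k, l) * cis (pi * (int_vec k \<bullet> int_vec l)) * lattice_char 1 k \<xi>)
        * K (\<xi> + int_vec (m + l), \<eta>))"
proof -
  have "(\<Sum>j\<in>index_cube N. c j * kernel_translation j K (\<xi> + int_vec m, \<eta>))
      = (\<Sum>k\<in>index_box N. \<Sum>l\<in>index_box N. c (k, l) * kernel_translation (k, l) K (\<xi> + int_vec m, \<eta>))"
    unfolding index_cube_eq by (simp add: sum.cartesian_product')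
  also have "\<dots> = (\<Sum>l\<in>index_box N. \<Sum>k\<in>index_box N. c (k, l) * kernel_translation (k, l) K (\<xi> + int_vec m, \<eta>))"
    by (rule sum.swap)
  also have "\<dots> = (\<Sum>l\<in>index_box N. (\<Sum>k\<in>index_box N. c (k, l) * cis (pi * (int_vec k \<bullet> int_vec l)) * lattice_char 1 k \<xi>)
        * K (\<xi> + int_vec (m + l), \<eta>))"
    using lattice_char_periodic[of 1 _ \<xi> m]
    by (simp add: kernel_translation_def sum_distrib_right mult.assoc add.assoc)
  finally show ?thesis .
qed

lemma borel_measurable_nn_integral_count_space:
  fixes f :: "'i::countable \<Rightarrow> 'a \<Rightarrow> ennreal"
  assumes [measurable]: "\<And>i. f i \<in> borel_measurable M"
  shows "(\<lambda>x. \<integral>\<^sup>+i. f i x \<partial>count_space UNIV) \<in> borel_measurable M"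
proof -
  interpret sigma_finite_measure "count_space (UNIV :: 'i set)"
    by (rule sigma_finite_measure_count_space)
  have "(\<lambda>z. f (snd z) (fst z)) \<in> borel_measurable (M \<Otimes>\<^sub>M count_space UNIV)"
    by (rule measurable_compose_countable) measurable
  then show ?thesis
    by (intro borel_measurable_nn_integral) (simp add: split_beta)
qed

text \<open>
  The squared norm of the kernel combination is folded onto the torus, where
  \<open>weighted_coefficient_le\<close> applies pointwise: the weight is finite almost everywhere since its
  integral over the torus is \<open>L2sq K\<close>.
\<close>

lemma weighted_coefficient_polynomial_le:
  fixes K :: "(real ^ 'n) \<times> (real ^ 'n) \<Rightarrow> complex"
  assumes [measurable]: "K \<in> borel_measurable borel" and K: "L2sq K < \<infinity>"
    and orth: "AE \<xi> in lborel. \<xi> \<in> cell 0 1 \<longrightarrow> (\<forall>l. l \<noteq> 0 \<longrightarrow>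
      ((\<lambda>m. \<integral>\<eta>. K (\<xi> + int_vec m, \<eta>) * cnj (K (\<xi> + int_vec (m + l), \<eta>)) \<partial>lborel) has_sum 0) UNIV)"
    and l0: "l0 \<in> index_box N"
  shows "(\<integral>\<^sup>+\<xi>. ennreal ((cmod (\<Sum>k\<in>index_box N. c (k, l0) * cis (pi * (int_vec k \<bullet> int_vec l0)) * lattice_char 1 k \<xi>))\<^sup>2) *
      (\<integral>\<^sup>+m. (\<integral>\<^sup>+\<eta>. ennreal ((cmod (K (\<xi> + int_vec m, \<eta>)))\<^sup>2) \<partial>lborel) \<partial>count_space UNIV) \<partial>cell_measure 0 1)
    \<le> L2sq (\<lambda>z. \<Sum>j\<in>index_cube N. c j * kernel_translation j K z)"
proof -
  define A where "A l \<xi> = (\<Sum>k\<in>index_box N. c (k, l) * cis (pi * (int_vec k \<bullet> int_vec l)) * lattice_char 1 k \<xi>)" for l \<xi>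
  define W where "W \<xi> = (\<integral>\<^sup>+m. (\<integral>\<^sup>+\<eta>. ennreal ((cmod (K (\<xi> + int_vec m, \<eta>)))\<^sup>2) \<partial>lborel) \<partial>count_space UNIV)" for \<xi>
  have fold: "L2sq G = (\<integral>\<^sup>+\<xi>\<in>cell 0 1. (\<integral>\<^sup>+m. (\<integral>\<^sup>+\<eta>. ennreal ((cmod (G (\<xi> + int_vec m, \<eta>)))\<^sup>2) \<partial>lborel) \<partial>count_space UNIV) \<partial>lborel)"
    if [measurable]: "G \<in> borel_measurable borel" for G :: "(real ^ 'n) \<times> (real ^ 'n) \<Rightarrow> complex"
  proof -
    have "L2sq G = (\<integral>\<^sup>+\<xi>. (\<integral>\<^sup>+\<eta>. ennreal ((cmod (G (\<xi>, \<eta>)))\<^sup>2) \<partial>lborel) \<partial>lborel)"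
      unfolding L2sq_def by (rule nn_integral_lborel_pair) measurable
    also have "\<dots> = (\<integral>\<^sup>+\<xi>\<in>cell 0 1. (\<integral>\<^sup>+m. (\<integral>\<^sup>+\<eta>. ennreal ((cmod (G (\<xi> + 1 *\<^sub>R int_vec m, \<eta>)))\<^sup>2) \<partial>lborel) \<partial>count_space UNIV) \<partial>lborel)"
      by (rule nn_integral_unfold) auto
    finally show ?thesis by simp
  qed
  have [measurable]: "W \<in> borel_measurable borel"
    unfolding W_def by (rule borel_measurable_nn_integral_count_space) measurable
  have "AE \<xi> in lborel. W \<xi> * indicator (cell 0 1) \<xi> \<noteq> \<infinity>"
    using K unfolding fold[OF assms(1)] W_def[symmetric] by (intro nn_integral_PInf_AE) auto
  then have "AE \<xi> in lborel. \<xi> \<in> cell 0 1 \<longrightarrow> ennreal ((cmod (A l0 \<xi>))\<^sup>2) * W \<xi>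
      \<le> (\<integral>\<^sup>+m. (\<integral>\<^sup>+\<eta>. ennreal ((cmod (\<Sum>l\<in>index_box N. A l \<xi> * K (\<xi> + int_vec (m + l), \<eta>)))\<^sup>2) \<partial>lborel) \<partial>count_space UNIV)"
    using orth
  proof eventually_elim
    case (elim \<xi>)
    show ?case
    proof
      assume "\<xi> \<in> cell 0 1"
      then show "ennreal ((cmod (A l0 \<xi>))\<^sup>2) * W \<xi>
        \<le> (\<integral>\<^sup>+m. (\<integral>\<^sup>+\<eta>. ennreal ((cmod (\<Sum>l\<in>index_box N. A l \<xi> * K (\<xi> + int_vec (m + l), \<eta>)))\<^sup>2) \<partial>lborel) \<partial>count_space UNIV)"
        unfolding W_def using elim
        by (intro weighted_coefficient_le[where v = "\<lambda>m \<eta>. K (\<xi> + int_vec m, \<eta>)" and a = "\<lambda>l. A l \<xi>"]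
            finite_index_box l0) (auto simp: W_def less_top)
    qed
  qed
  then have "(\<integral>\<^sup>+\<xi>\<in>cell 0 1. (ennreal ((cmod (A l0 \<xi>))\<^sup>2) * W \<xi>) \<partial>lborel)
      \<le> (\<integral>\<^sup>+\<xi>\<in>cell 0 1. (\<integral>\<^sup>+m. (\<integral>\<^sup>+\<eta>. ennreal ((cmod (\<Sum>l\<in>index_box N. A l \<xi> * K (\<xi> + int_vec (m + l), \<eta>)))\<^sup>2) \<partial>lborel) \<partial>count_space UNIV) \<partial>lborel)"
    by (intro nn_integral_mono_AE) (auto elim!: eventually_mono simp: indicator_def)
  also have "\<dots> = L2sq (\<lambda>z. \<Sum>j\<in>index_cube N. c j * kernel_translation j K z)"
    by (subst fold) (auto simp: kernel_combination_slice A_def)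
  finally show ?thesis
    by (simp add: A_def W_def nn_integral_restrict_space)
qed

lemma AE_twisted_translation:
  fixes \<phi> f :: "(real ^ 'n) \<times> (real ^ 'n) \<Rightarrow> complex"
  assumes "AE z in lborel. \<phi> z = f z"
  shows "AE z in lborel. \<forall>j. twisted_translation j \<phi> z = twisted_translation j f z"
  unfolding AE_all_countable
proof
  fix j :: "(int ^ 'n) \<times> (int ^ 'n)"
  show "AE z in lborel. twisted_translation j \<phi> z = twisted_translation j f z"
    using AE_lborel_translate[OF assms, of "(- int_vec (fst j), - int_vec (snd j))"]
    by eventually_elim (simp add: twisted_translation_eq plus_prod_def)
qed

theorem theorem4p1:
  fixes \<phi> :: "(real ^ 'n) \<times> (real ^ 'n) \<Rightarrow> complex"
  assumes "in_L2 \<phi>"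
    and "condition_C \<phi>"
    and "AE \<xi> in lebesgue_on torus. weight \<phi> \<xi> > 0"
  shows "ell2_independent (\<lambda>j. twisted_translation j \<phi>)"
proof
  assume "ell2_dependent (\<lambda>j. twisted_translation j \<phi>)"
  then obtain c :: "(int ^ 'n) \<times> (int ^ 'n) \<Rightarrow> complex" and j0 where j0: "c j0 \<noteq> 0"
    and sq: "(\<lambda>j. (cmod (c j))\<^sup>2) summable_on UNIV"
    and "L2_limit (\<lambda>N z. \<Sum>j\<in>index_cube N. c j * twisted_translation j \<phi> z) (\<lambda>_. 0)"
    unfolding ell2_dependent_def by blast
  then have lim: "(\<lambda>N. L2sq (\<lambda>z. \<Sum>j\<in>index_cube N. c j * twisted_translation j \<phi> z)) \<longlonglongrightarrow> 0"
    by (simp add: L2_limit_iff)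
  obtain k0 l0 where j0_eq: "j0 = (k0, l0)" by (cases j0)
  obtain f K where f: "f \<in> borel_measurable borel" "AE z in lborel. \<phi> z = f z" "L2sq f < \<infinity>"
    and K [measurable]: "K \<in> borel_measurable borel" and \<phi>K: "AE z in lborel. weyl_kernel \<phi> z = K z"
    and KL2: "L2sq K < \<infinity>"
    and trunc: "(\<lambda>N. L2sq (\<lambda>z. weyl_integral (x_truncate N f) z - K z)) \<longlonglongrightarrow> 0"
    using weyl_kernel_borel_representatives[OF assms(1)] .
  note slices = AE_lattice_slices[OF \<phi>K]

  have orth: "AE \<xi> in lborel. \<xi> \<in> cell 0 1 \<longrightarrow> (\<forall>l. l \<noteq> 0 \<longrightarrow>
      ((\<lambda>m. \<integral>\<eta>. K (\<xi> + int_vec m, \<eta>) * cnj (K (\<xi> + int_vec (m + l), \<eta>)) \<partial>lborel) has_sum 0) UNIV)"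
  proof -
    have "AE \<xi> in lborel. \<forall>l. \<xi> \<in> cell 0 1 \<longrightarrow> l \<noteq> 0 \<longrightarrow> ((\<lambda>m. LINT \<eta>|lebesgue.
        weyl_kernel \<phi> (\<xi> + int_vec m, \<eta>) * cnj (weyl_kernel \<phi> (\<xi> + int_vec m + int_vec l, \<eta>))) has_sum 0) UNIV"
      using assms(2) unfolding AE_all_countable condition_C_def AE_torus_iff
      by (auto elim: eventually_mono)
    then show ?thesis
      using slices
    proof eventually_elim
      case (elim \<xi>)
      have "(LINT \<eta>|lebesgue. weyl_kernel \<phi> (\<xi> + int_vec m, \<eta>) *
            cnj (weyl_kernel \<phi> (\<xi> + int_vec m + int_vec l, \<eta>)))
          = (\<integral>\<eta>. K (\<xi> + int_vec m, \<eta>) * cnj (K (\<xi> + int_vec (m + l), \<eta>)) \<partial>lborel)" for m l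
      proof (rule lebesgue_integral_borel_representative)
        show "AE \<eta> in lborel. weyl_kernel \<phi> (\<xi> + int_vec m, \<eta>) *
            cnj (weyl_kernel \<phi> (\<xi> + int_vec m + int_vec l, \<eta>))
          = K (\<xi> + int_vec m, \<eta>) * cnj (K (\<xi> + int_vec (m + l), \<eta>))"
          using elim(2)[rule_format, of m] elim(2)[rule_format, of "m + l"]
          by eventually_elim (simp add: add.assoc)
      qed measurable
      with elim(1) show ?case by simp
    qed
  qed

  define W where "W \<xi> = (\<integral>\<^sup>+m. (\<integral>\<^sup>+\<eta>. ennreal ((cmod (K (\<xi> + int_vec m, \<eta>)))\<^sup>2) \<partial>lborel) \<partial>count_space UNIV)" for \<xi>
  have W [measurable]: "W \<in> borel_measurable borel"
    unfolding W_def by (rule borel_measurable_nn_integral_count_space) measurable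
  have "AE \<xi> in lborel. \<xi> \<in> cell 0 1 \<longrightarrow> 0 < W \<xi>"
    using assms(3) slices unfolding AE_torus_iff
  proof eventually_elim
    case (elim \<xi>)
    have eq: "(\<integral>\<^sup>+\<eta>. ennreal ((cmod (weyl_kernel \<phi> (\<xi> + int_vec m, \<eta>)))\<^sup>2) \<partial>lebesgue)
        = (\<integral>\<^sup>+\<eta>. ennreal ((cmod (K (\<xi> + int_vec m, \<eta>)))\<^sup>2) \<partial>lborel)" for m
      unfolding nn_integral_completion
      by (rule nn_integral_cong_AE) (use elim(2) in \<open>auto elim: eventually_mono dest: spec[of _ m]\<close>)
    have "weight \<phi> \<xi> = 0" if "W \<xi> = 0"
      using that unfolding weight_def eq W_def
      by (subst (asm) nn_integral_0_iff_AE) (auto simp: AE_count_space)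
    with elim(1) show ?case
      by (auto simp: zero_less_iff_neq_zero)
  qed
  then have W_pos: "AE \<xi> in cell_measure 0 1. 0 < W \<xi>"
    by (subst AE_restrict_space_iff) auto

  define d where "d k = c (k, l0) * cis (pi * (int_vec k \<bullet> int_vec l0))" for k
  have "d k0 = 0"
  proof (rule coefficient_vanishes[OF W W_pos finite_index_box eventually_in_index_box])
    fix N
    have "(\<Sum>k\<in>index_box N. (cmod (d k))\<^sup>2) = (\<Sum>j\<in>(\<lambda>k. (k, l0)) ` index_box N. (cmod (c j))\<^sup>2)"
      by (subst sum.reindex) (auto simp: inj_on_def d_def norm_mult)
    also have "\<dots> \<le> (\<Sum>\<^sub>\<infinity>j. (cmod (c j))\<^sup>2)"
      by (rule finite_sum_le_infsum[OF sq]) (auto simp: finite_index_box)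
    finally show "(\<Sum>k\<in>index_box N. (cmod (d k))\<^sup>2) \<le> (\<Sum>\<^sub>\<infinity>j. (cmod (c j))\<^sup>2)" .
  next
    have upper: "\<forall>\<^sub>F N in sequentially.
        (\<integral>\<^sup>+\<xi>. ennreal ((cmod (\<Sum>k\<in>index_box N. d k * lattice_char 1 k \<xi>))\<^sup>2) * W \<xi> \<partial>cell_measure 0 1)
        \<le> 4 * L2sq (\<lambda>z. \<Sum>j\<in>index_cube N. c j * twisted_translation j \<phi> z)"
      using eventually_in_index_box[of l0]
    proof eventually_elim
      case (elim N)
      have "(\<integral>\<^sup>+\<xi>. ennreal ((cmod (\<Sum>k\<in>index_box N. d k * lattice_char 1 k \<xi>))\<^sup>2) * W \<xi> \<partial>cell_measure 0 1)
          \<le> L2sq (\<lambda>z. \<Sum>j\<in>index_cube N. c j * kernel_translation j K z)"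
        unfolding d_def W_def by (rule weighted_coefficient_polynomial_le[OF K KL2 orth elim])
      also have "\<dots> \<le> 4 * L2sq (\<lambda>z. \<Sum>j\<in>index_cube N. c j * twisted_translation j f z)"
        by (rule L2sq_kernel_combination_le[OF f(1) K f(3) _ trunc])
           (simp add: index_cube_eq finite_index_box)
      also have "L2sq (\<lambda>z. \<Sum>j\<in>index_cube N. c j * twisted_translation j f z)
          = L2sq (\<lambda>z. \<Sum>j\<in>index_cube N. c j * twisted_translation j \<phi> z)"
        using AE_twisted_translation[OF f(2)]
        by (intro L2sq_cong_AE, eventually_elim) (simp del: split_paired_All)
      finally show ?case .
    qed
    have upper_lim: "(\<lambda>N. 4 * L2sq (\<lambda>z. \<Sum>j\<in>index_cube N. c j * twisted_translation j \<phi> z)) \<longlonglongrightarrow> 0"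
      using ennreal_tendsto_cmult[OF _ lim, of 4] by simp
    show "(\<lambda>N. \<integral>\<^sup>+\<xi>. ennreal ((cmod (\<Sum>k\<in>index_box N. d k * lattice_char 1 k \<xi>))\<^sup>2) * W \<xi>
        \<partial>cell_measure 0 1) \<longlonglongrightarrow> 0"
      by (rule tendsto_sandwich[OF _ upper tendsto_const upper_lim]) (rule always_eventually, simp)
  qed
  then show False
    using j0 by (simp add: d_def j0_eq)
qed

end
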